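(* Let $n\ge 2$ and let $\lambda$ be a number-partition of $n$. Let $\widehat{\mathcal{H}yp}^n_\lambda$ denote the one-point compactification of $\mathcal{H}yp^n_\lambda$. Then: (a) $\widehat{\mathcal{H}yp}^n_\lambda$ is homeomorphic to the double suspension of $\delta_\lambda$. In particular, the homeomorphism type of $\widehat{\mathcal{H}yp}^n_\lambda$ depends only on the combinatorics of $\lambda$. (b) $\widehat{\mathcal{H}yp}^n_\lambda$ is homotopy equivalent to the double suspension of the order complex $\Delta(C_\lambda)$. In particular, if $\lambda$ is a number-partition of $n$, $\lambda'$ is a number-partition of $m$, and $C_\lambda\cong C_{\lambda'}$ as posets, then $\widehat{\mathcal{H}yp}^n_\lambda\simeq\widehat{\mathcal{H}yp}^m_{\lambda'}$.
   Context: For $\lambda=(\lambda_1\le\cdots\le\lambda_t)$ a number-partition of $n$, $\mathcal{H}yp^n_\lambda\subseteq\mathbb{R}^n$ is the set of monic real polynomials $\prod_{i=1}^t(X-y_i)^{\lambda_i}$ with $y_1,\dots,y_t\in\mathbb{R}$ arbitrary, topologized via coefficients (this is the closure of the set of hyperbolic polynomials whose root multiplicities, listed in increasing order of the roots, form a composition of type $\lambda$). A composition of $n$ is an ordered tuple $(a_1,\dots,a_t)$ of positive integers with sum $n$, identified with the set-partition of $[n]$ into consecutive intervals of these lengths; compositions are ordered by refinement ($\pi\preceq\sigma$ if every block of $\pi$ lies in a block of $\sigma$), with join the finest common coarsening; a composition has type $\lambda$ if its multiset of parts is $\lambda$. $C_\lambda$ is the poset of all compositions of $n$ that are joins of nonempty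 families of compositions of type $\lambda$, excluding the one-block composition $(n)$; $\Delta(P)$ is the order complex (complex of chains) of a poset $P$. Let $V=\{v_1,\dots,v_{n-1}\}$ be the vertex set of an $(n-2)$-simplex; for nonempty $F\subseteq V$ let $c(F)$ be the composition of $n$ in which $i,i+1$ lie in the same block iff $v_i\notin F$. $\delta_\lambda$ is the simplicial complex of all nonempty $F\subseteq V$ contained in some $G$ with $c(G)$ of type $\lambda$. The suspension of the empty space is $S^0$. *)

theory Defs
  imports "HOL-Analysis.Analysis" "HOL-Computational_Algebra.Polynomial"
begin

section \<open>Number-partitions and compositions\<close>

definition number_partition :: "nat \<Rightarrow> nat list \<Rightarrow> bool" where
  "number_partition n lam \<longleftrightarrow> sorted lam \<and> 0 \<notin> set lam \<and> sum_list lam = n"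

definition composition :: "nat \<Rightarrow> nat list \<Rightarrow> bool" where
  "composition n a \<longleftrightarrow> 0 \<notin> set a \<and> sum_list a = n"

definition has_type :: "nat list \<Rightarrow> nat list \<Rightarrow> bool" where
  "has_type lam a \<longleftrightarrow> mset a = mset lam"

text \<open>The set-partition of \<open>{1..n}\<close> into consecutive intervals with which a composition
  of \<open>n\<close> is identified; for instance \<open>[2,1]\<close> becomes \<open>{{1,2},{3}}\<close>.\<close>

definition blocks :: "nat list \<Rightarrow> nat set set" where
  "blocks a = {{sum_list (take k a) + 1 .. sum_list (take (Suc k) a)} | k. k < length a}"

definition comp_le :: "nat \<Rightarrow> nat list \<Rightarrow> nat list \<Rightarrow> bool" where
  "comp_le n a b \<longleftrightarrow> refines {1..n} (blocks a) (blocks b)"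

definition is_comp_join :: "nat \<Rightarrow> nat list set \<Rightarrow> nat list \<Rightarrow> bool" where
  "is_comp_join n S c \<longleftrightarrow>
     composition n c \<and> (\<forall>a\<in>S. comp_le n a c) \<and>
     (\<forall>d. composition n d \<and> (\<forall>a\<in>S. comp_le n a d) \<longrightarrow> comp_le n c d)"

definition C_poset :: "nat \<Rightarrow> nat list \<Rightarrow> nat list set" where
  "C_poset n lam =
     {c. \<exists>S. S \<noteq> {} \<and> S \<subseteq> {a. composition n a \<and> has_type lam a} \<and> is_comp_join n S c} - {[n]}"

definition poset_iso ::
  "('a \<Rightarrow> 'a \<Rightarrow> bool) \<Rightarrow> 'a set \<Rightarrow> ('b \<Rightarrow> 'b \<Rightarrow> bool) \<Rightarrow> 'b set \<Rightarrow> bool" where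
  "poset_iso le P le' Q \<longleftrightarrow>
     (\<exists>f. bij_betw f P Q \<and> (\<forall>x\<in>P. \<forall>y\<in>P. le x y \<longleftrightarrow> le' (f x) (f y)))"

section \<open>Abstract simplicial complexes\<close>

text \<open>A complex is given by its set of nonempty finite faces.\<close>

definition order_complex :: "('a \<Rightarrow> 'a \<Rightarrow> bool) \<Rightarrow> 'a set \<Rightarrow> 'a set set" where
  "order_complex le P =
     {c. c \<noteq> {} \<and> finite c \<and> c \<subseteq> P \<and> Complete_Partial_Order.chain le c}"

definition simplicial_iso :: "'a set set \<Rightarrow> 'b set set \<Rightarrow> bool" where
  "simplicial_iso K L \<longleftrightarrow> (\<exists>f. bij_betw f (\<Union>K) (\<Union>L) \<and> (\<lambda>F. f ` F) ` K = L)"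

text \<open>Geometric realization in barycentric coordinates. The subspace topology is the
  usual (weak) one for finite complexes, which are the only ones used here.\<close>

definition realization :: "'a set set \<Rightarrow> ('a \<Rightarrow> real) topology" where
  "realization K =
     subtopology (powertop_real UNIV)
       {x. (\<forall>v. 0 \<le> x v) \<and> {v. x v \<noteq> 0} \<in> K \<and> (\<Sum>v | x v \<noteq> 0. x v) = 1}"

text \<open>The vertex \<open>v\<^sub>i\<close> is represented by the number \<open>i\<close>, so that \<open>V = {1..<n}\<close>.\<close>

text \<open>\<open>comp_of n F\<close> is the unique composition of \<open>n\<close> whose breaks are the members of \<open>F\<close>.\<close>

definition comp_of :: "nat \<Rightarrow> nat set \<Rightarrow> nat list" where
  "comp_of n F =
     (THE a. composition n a \<and>
        (\<forall>i\<in>{1..<n}. (\<exists>B\<in>blocks a. i \<in> B \<and> Suc i \<in> B) \<longleftrightarrow> i \<notin> F))"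

definition delta :: "nat \<Rightarrow> nat list \<Rightarrow> nat set set" where
  "delta n lam =
     {F. F \<noteq> {} \<and> F \<subseteq> {1..<n} \<and>
         (\<exists>G. F \<subseteq> G \<and> G \<subseteq> {1..<n} \<and> has_type lam (comp_of n G))}"

section \<open>Suspension\<close>

text \<open>The unreduced suspension: \<open>X \<times> [-1,1]\<close> with the two ends collapsed to two distinct
  poles. The poles are present even if \<open>X\<close> is empty, so the suspension of the empty space is
  the two-point discrete space.\<close>

datatype 'a susp = South | North | Mid 'a real

definition susp_map :: "'a \<times> real \<Rightarrow> 'a susp" where
  "susp_map = (\<lambda>(x, t). if t = -1 then South else if t = 1 then North else Mid x t)"

definition susp_carrier :: "'a topology \<Rightarrow> 'a susp set" where
  "susp_carrier X = {South, North} \<union> {Mid x t | x t. x \<in> topspace X \<and> -1 < t \<and> t < 1}"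

definition susp_cylinder :: "'a topology \<Rightarrow> ('a \<times> real) topology" where
  "susp_cylinder X = prod_topology X (top_of_set {-1..1})"

text \<open>The quotient topology along \<^const>\<open>susp_map\<close>.\<close>

definition suspension :: "'a topology \<Rightarrow> 'a susp topology" where
  "suspension X =
     topology (\<lambda>U. U \<subseteq> susp_carrier X \<and>
       openin (susp_cylinder X) {p \<in> topspace (susp_cylinder X). susp_map p \<in> U})"

lemma openin_suspension:
  "openin (suspension X) U \<longleftrightarrow> U \<subseteq> susp_carrier X \<and>
     openin (susp_cylinder X) {p \<in> topspace (susp_cylinder X). susp_map p \<in> U}"
proof -
  let ?Z = "susp_cylinder X"
  have int: "{p \<in> topspace ?Z. susp_map p \<in> S \<inter> T} =
      {p \<in> topspace ?Z. susp_map p \<in> S} \<inter> {p \<in> topspace ?Z. susp_map p \<in> T}" for S T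
    by auto
  have un: "{p \<in> topspace ?Z. susp_map p \<in> \<Union>\<K>} =
      (\<Union>K\<in>\<K>. {p \<in> topspace ?Z. susp_map p \<in> K})" for \<K>
    by auto
  have "istopology (\<lambda>U. U \<subseteq> susp_carrier X \<and>
      openin ?Z {p \<in> topspace ?Z. susp_map p \<in> U})"
    unfolding istopology_def int un by blast
  then show ?thesis
    by (simp add: suspension_def)
qed

lemma topspace_suspension [simp]: "topspace (suspension X) = susp_carrier X"
proof
  show "topspace (suspension X) \<subseteq> susp_carrier X"
    using openin_suspension openin_topspace by blast
  have "susp_map p \<in> susp_carrier X" if "p \<in> topspace (susp_cylinder X)" for p
    using that by (cases p) (force simp: susp_map_def susp_carrier_def susp_cylinder_def)
  then have "{p \<in> topspace (susp_cylinder X). susp_map p \<in> susp_carrier X}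
      = topspace (susp_cylinder X)"
    by blast
  then show "susp_carrier X \<subseteq> topspace (suspension X)"
    by (metis openin_subset openin_suspension openin_topspace subset_refl)
qed

section \<open>Strata of hyperbolic polynomials\<close>

definition hyp_polys :: "nat list \<Rightarrow> real poly set" where
  "hyp_polys lam = {\<Prod>i<length lam. [:- y i, 1:] ^ (lam ! i) | y :: nat \<Rightarrow> real. True}"

text \<open>The topology given by the coefficients. All members are monic of the same
  degree \<open>n = sum_list lam\<close>, so this is the subspace topology coming from the identification of such polynomials with their
  vectors of lower coefficients in \<open>\<real>\<^sup>n\<close>.\<close>

definition Hyp :: "nat list \<Rightarrow> real poly topology" where
  "Hyp lam = pullback_topology (hyp_polys lam) coeff (powertop_real UNIV)"

end

theory Submission
  imports Defs "HOL-Combinatorics.List_Permutation"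
begin

text \<open>
  A member of the stratum is determined by its smallest root and the gaps between consecutive
  roots. The gap vectors that occur are the nonnegative vectors whose support is a face of
  \<open>\<delta>\<^sub>\<lambda>\<close> (or empty), so the stratum is the product of a line with the open cone over
  \<open>|\<delta>\<^sub>\<lambda>|\<close>, the inverse map being continuous because roots are bounded in terms of coefficients.
  In barycentric coordinates the double suspension of \<open>|K|\<close> is the unit sphere
  \<open>\<Sum>y + |t| + |u| = 1\<close> in the cone over \<open>|K|\<close> times the plane, and stereographic projection from the pole
  \<open>u = 1\<close> identifies the complement of that pole with the cone times a line; uniqueness of the
  one-point compactification gives (a).

  For (b), \<open>C\<^sub>\<lambda>\<close> is dual to the poset of nonempty intersections of facets of
  \<open>\<delta>\<^sub>\<lambda>\<close>. A point \<open>x\<close> of the cone over \<open>\<delta>\<^sub>\<lambda>\<close> is sent to the chain of closures of its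
  superlevel sets \<open>{x \<ge> s}\<close>, each weighted by the length of the range of levels \<open>s\<close> that produce it; a
  weighted chain is sent to the weighted sum of the indicators of its members. Both
  composites stay in a common face with the identity, so straight lines are homotopies.
\<close>

section \<open>Cones over complexes and double suspensions\<close>

text \<open>With the 1-norm, suspending a unit sphere means adding one coordinate, so cones, spheres
  and suspensions all live in products of a function space with lines. Every cone contains its apex,
  and so the empty complex, which arises exactly for the one-part partition, is treated uniformly:
  its cone is a point and its sphere is the circle |t| + |u| = 1.

  In (b), sending a face to its closure is a monotone map between posets, and realizing it directly
  would call for barycentric subdivision. Superlevel sets provide the subdivision implicitly: a
  nonnegative function is the integral over all levels of the indicators of its superlevel sets, and
  these form a chain of faces. Taking closures preserves the chain. The length of a range of levels
  is a difference of minima and maxima of coordinates, cut off at 0, and therefore depends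
  continuously on the point even where the chain itself jumps.\<close>

definition complex_on :: "'a set set \<Rightarrow> bool" where
  "complex_on K \<longleftrightarrow> finite K \<and> (\<forall>F\<in>K. finite F \<and> F \<noteq> {} \<and> (\<forall>G. G \<subseteq> F \<longrightarrow> G \<noteq> {} \<longrightarrow> G \<in> K))"

definition cone_of :: "'a set set \<Rightarrow> ('a \<Rightarrow> real) set" where
  "cone_of K = {x. (\<forall>v. 0 \<le> x v) \<and> {v. x v \<noteq> 0} \<in> insert {} K}"

text \<open>The sum runs over the fixed finite vertex set rather than over the support of
  \<open>x\<close>, which makes continuity in \<open>x\<close> immediate; on the cone the two sums
  agree.\<close>

definition mass :: "'a set set \<Rightarrow> ('a \<Rightarrow> real) \<Rightarrow> real" where
  "mass K x = (\<Sum>v\<in>\<Union>K. x v)"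

definition fun_scale :: "real \<Rightarrow> ('a \<Rightarrow> real) \<Rightarrow> 'a \<Rightarrow> real" where
  "fun_scale c x = (\<lambda>v. c * x v)"

definition pair_scale :: "real \<Rightarrow> ('a \<Rightarrow> real) \<times> real \<Rightarrow> ('a \<Rightarrow> real) \<times> real" where
  "pair_scale c p = (fun_scale c (fst p), c * snd p)"

definition pair_mass :: "'a set set \<Rightarrow> ('a \<Rightarrow> real) \<times> real \<Rightarrow> real" where
  "pair_mass K p = mass K (fst p) + \<bar>snd p\<bar>"

definition sphere_of :: "'a set set \<Rightarrow> ((('a \<Rightarrow> real) \<times> real) \<times> real) set" where
  "sphere_of K = {q. fst q \<in> cone_of K \<times> UNIV \<and> pair_mass K (fst q) + \<bar>snd q\<bar> = 1}"

text \<open>Homotopies are easier on this space than on the sphere, since no normalization is needed.\<close>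

definition punctured_cone :: "'a set set \<Rightarrow> ((('a \<Rightarrow> real) \<times> real) \<times> real) set" where
  "punctured_cone K = {q. fst q \<in> cone_of K \<times> UNIV \<and> pair_mass K (fst q) + \<bar>snd q\<bar> \<noteq> 0}"

lemma complex_on_finite_vertices: "complex_on K \<Longrightarrow> finite (\<Union>K)"
  by (auto simp: complex_on_def)

lemma zero_in_cone_of [simp]: "(\<lambda>v. 0) \<in> cone_of K"
  by (simp add: cone_of_def)

lemma cone_of_nonneg: "x \<in> cone_of K \<Longrightarrow> 0 \<le> x v"
  by (simp add: cone_of_def)

lemma cone_of_outside: "x \<in> cone_of K \<Longrightarrow> v \<notin> \<Union>K \<Longrightarrow> x v = 0"
  by (auto simp: cone_of_def)

lemma mass_nonneg: "x \<in> cone_of K \<Longrightarrow> 0 \<le> mass K x"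
  by (simp add: mass_def sum_nonneg cone_of_nonneg)

lemma mass_scale: "mass K (fun_scale c x) = c * mass K x"
  by (simp add: mass_def fun_scale_def sum_distrib_left)

lemma mass_eq_0_iff:
  assumes "complex_on K" "x \<in> cone_of K"
  shows "mass K x = 0 \<longleftrightarrow> x = (\<lambda>v. 0)"
proof -
  have "mass K x = 0 \<longleftrightarrow> (\<forall>v\<in>\<Union>K. x v = 0)"
    unfolding mass_def using assms cone_of_nonneg complex_on_finite_vertices
    by (subst sum_nonneg_eq_0_iff) auto
  then show ?thesis
    using cone_of_outside[OF assms(2)] by (auto simp: fun_eq_iff)
qed

lemma cone_of_scale:
  assumes "x \<in> cone_of K" "0 \<le> c"
  shows "fun_scale c x \<in> cone_of K"
  using assms by (cases "c = 0") (auto simp: cone_of_def fun_scale_def)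

lemma cone_of_supportI:
  assumes "complex_on K" "F \<in> K" "\<And>v. 0 \<le> x v" "\<And>v. x v \<noteq> 0 \<Longrightarrow> v \<in> F"
  shows "x \<in> cone_of K"
proof -
  have "{v. x v \<noteq> 0} \<subseteq> F" using assms(4) by auto
  then show ?thesis
    using assms(1-3) by (cases "{v. x v \<noteq> 0} = {}") (auto simp: cone_of_def complex_on_def)
qed

lemma continuous_on_coord [continuous_intros]:
  fixes S :: "('a \<Rightarrow> 'b::topological_space) set"
  shows "continuous_on S (\<lambda>x. x v)"
  using continuous_on_id by (rule continuous_on_product_then_coordinatewise)

lemma continuous_on_fst_coord [continuous_intros]:
  fixes S :: "(('a \<Rightarrow> 'b::topological_space) \<times> 'c::topological_space) set"
  shows "continuous_on S (\<lambda>p. fst p v)"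
  using continuous_on_fst[OF continuous_on_id] by (rule continuous_on_product_then_coordinatewise)

lemma continuous_on_mass [continuous_intros]:
  "continuous_on S f \<Longrightarrow> continuous_on S (\<lambda>x. mass K (f x))"
  unfolding mass_def
  by (rule continuous_on_sum) (rule continuous_on_product_then_coordinatewise)

text \<open>There are finitely many faces, and for each of them the nonnegative functions vanishing
  off it are cut out by closed conditions on single coordinates.\<close>

lemma closed_cone_of:
  assumes "complex_on K"
  shows "closed (cone_of K)"
proof -
  have "cone_of K = (\<Union>F\<in>insert {} K. {x. \<forall>v. 0 \<le> x v \<and> (v \<notin> F \<longrightarrow> x v = 0)})" (is "_ = (\<Union>F\<in>_. ?C F)")
  proof (intro equalityI subsetI)
    fix x assume "x \<in> cone_of K"
    then have "{v. x v \<noteq> 0} \<in> insert {} K" "x \<in> ?C {v. x v \<noteq> 0}"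
      by (auto simp: cone_of_def)
    then show "x \<in> (\<Union>F\<in>insert {} K. ?C F)" by blast
  next
    fix x assume "x \<in> (\<Union>F\<in>insert {} K. ?C F)"
    then obtain F where F: "F \<in> insert {} K" "x \<in> ?C F" by blast
    show "x \<in> cone_of K"
    proof (cases "F = {}")
      case True
      with F have "x = (\<lambda>v. 0)" by auto
      then show ?thesis by simp
    next
      case False
      with F assms show ?thesis by (intro cone_of_supportI[of K F]) auto
    qed
  qed
  moreover have clo: "closed (?C F)" for F
  proof -
    have "?C F = (\<Inter>v. {x. 0 \<le> x v}) \<inter> (\<Inter>v\<in>-F. {x. x v = 0})" by auto
    moreover have "closed {x::'a \<Rightarrow> real. 0 \<le> x v}" "closed {x::'a \<Rightarrow> real. x v = 0}" for v
      by (auto intro!: closed_Collect_le closed_Collect_eq continuous_intros)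
    ultimately show ?thesis by (simp add: closed_INT closed_Int)
  qed
  moreover have "finite (insert {} K)" using assms by (simp add: complex_on_def)
  then have "closed (\<Union>F\<in>insert {} K. ?C F)" by (rule closed_UN) (use clo in blast)
  ultimately show ?thesis by (simp only:)
qed

lemma Hausdorff_space_euclidean_fun:
  "Hausdorff_space (euclidean :: ('a \<Rightarrow> real) topology)"
proof -
  have "Hausdorff_space (product_topology (\<lambda>_::'a. euclidean :: real topology) UNIV)"
    unfolding Hausdorff_space_product_topology by (simp add: Hausdorff_space_euclidean)
  then show ?thesis by (simp only: euclidean_product_topology)
qed

lemma realization_eq:
  assumes "complex_on K"
  shows "realization K = top_of_set {x \<in> cone_of K. mass K x = 1}"
proof -
  have "{} \<notin> K" using assms by (auto simp: complex_on_def)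
  have eq: "(\<Sum>v | x v \<noteq> 0. x v) = mass K x" if "{v. x v \<noteq> 0} \<in> K" for x
    unfolding mass_def
    using that complex_on_finite_vertices[OF assms] by (intro sum.mono_neutral_left) auto
  have "{x. (\<forall>v. 0 \<le> x v) \<and> {v. x v \<noteq> 0} \<in> K \<and> (\<Sum>v | x v \<noteq> 0. x v) = 1}
      = {x \<in> cone_of K. mass K x = 1}"
    using \<open>{} \<notin> K\<close> eq by (auto simp: cone_of_def mass_def)
  then show ?thesis
    by (simp add: realization_def euclidean_product_topology)
qed

lemma compact_space_realization:
  assumes "complex_on K"
  shows "compact_space (realization K)"
proof -
  let ?R = "{x \<in> cone_of K. mass K x = 1}"
  let ?B = "PiE UNIV (\<lambda>_::'a. {0..1::real})"
  \<comment> \<open>Coordinates range over a whole type, possibly infinite, so compactness of the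
    cube is Tychonoff's theorem.\<close>
  have "compactin euclidean ?B"
    unfolding euclidean_product_topology[symmetric] compactin_PiE by simp
  moreover have "?R \<subseteq> ?B"
  proof (intro subsetI PiE_I)
    fix x v assume "x \<in> ?R"
    then have x: "x \<in> cone_of K" "mass K x = 1" by auto
    have "x v \<le> 1" if "v \<in> \<Union>K"
      using member_le_sum[of v "\<Union>K" x] that x complex_on_finite_vertices[OF assms]
      by (auto simp: mass_def cone_of_nonneg)
    then show "x v \<in> {0..1}"
      using x cone_of_nonneg[of x K v] cone_of_outside[of x K v] by (cases "v \<in> \<Union>K") auto
  qed auto
  moreover have "closed ?R"
  proof -
    have "closed {x. mass K x = 1}"
      by (intro closed_Collect_eq continuous_on_mass continuous_on_id continuous_on_const)
    then have "closed (cone_of K \<inter> {x. mass K x = 1})"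
      by (intro closed_Int closed_cone_of assms)
    then show ?thesis by (simp add: Collect_conj_eq)
  qed
  then have "closedin euclidean ?R" by (simp only: closed_closedin)
  ultimately have "compactin euclidean ?R"
    by (rule closed_compactin)
  then show ?thesis
    by (simp add: realization_eq[OF assms] compact_space_subtopology)
qed

section \<open>Suspensions: compactness, maps out of them, embeddings as unit spheres\<close>

lemma susp_map_in_carrier:
  assumes "p \<in> topspace (susp_cylinder X)"
  shows "susp_map p \<in> susp_carrier X"
proof -
  obtain x t where "p = (x, t)" "x \<in> topspace X" "-1 \<le> t" "t \<le> 1"
    using assms by (auto simp: susp_cylinder_def)
  then show ?thesis
    by (cases "t = -1 \<or> t = 1") (auto simp: susp_map_def susp_carrier_def)
qed

lemma compact_space_suspension:
  assumes "compact_space X"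
  shows "compact_space (suspension X)"
proof -
  let ?Z = "susp_cylinder X"
  have "continuous_map ?Z (suspension X) susp_map"
    unfolding continuous_map_def
  proof (intro conjI allI impI)
    show "susp_map \<in> topspace ?Z \<rightarrow> topspace (suspension X)"
      using susp_map_in_carrier by auto
  qed (simp add: openin_suspension)
  moreover have "compact_space ?Z"
    unfolding susp_cylinder_def using assms
    by (simp add: compact_space_prod_topology compact_space_subtopology)
  ultimately have "compactin (suspension X) (susp_map ` topspace ?Z)"
    using image_compactin compact_space_def by blast
  \<comment> \<open>Over an empty \<open>X\<close> the cylinder is empty and its image misses the
    poles, so they are added separately.\<close>
  moreover have "compactin (suspension X) {South, North}"
    by (rule finite_imp_compactin) (auto simp: susp_carrier_def)
  ultimately have "compactin (suspension X) ({South, North} \<union> susp_map ` topspace ?Z)"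
    by (rule compactin_Un[rotated])
  moreover have "{South, North} \<union> susp_map ` topspace ?Z = topspace (suspension X)"
  proof
    show "{South, North} \<union> susp_map ` topspace ?Z \<subseteq> topspace (suspension X)"
      using susp_map_in_carrier[of _ X] by (force simp: susp_carrier_def)
    have "Mid x t \<in> susp_map ` topspace ?Z" if "x \<in> topspace X" "-1 < t" "t < 1" for x t
      using that by (intro image_eqI[of _ _ "(x, t)"]) (auto simp: susp_map_def susp_cylinder_def)
    then show "topspace (suspension X) \<subseteq> {South, North} \<union> susp_map ` topspace ?Z"
      by (auto simp: susp_carrier_def)
  qed
  ultimately show ?thesis by (simp add: compact_space_def)
qed

text \<open>The universal property of the quotient. The conditions at the poles speak for empty
  \<open>X\<close>, where no point of the cylinder maps to a pole.\<close>

lemma continuous_map_from_suspension: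
  assumes "continuous_map (susp_cylinder X) Y (g \<circ> susp_map)"
    and "g South \<in> topspace Y" "g North \<in> topspace Y"
  shows "continuous_map (suspension X) Y g"
  unfolding continuous_map_def
proof (intro conjI allI impI)
  have *: "g (susp_map p) \<in> topspace Y" if "p \<in> topspace (susp_cylinder X)" for p
    using assms(1) that by (auto simp: continuous_map_def)
  have "g (Mid x t) \<in> topspace Y" if "x \<in> topspace X" "-1 < t" "t < 1" for x t
    using *[of "(x, t)"] that by (simp add: susp_map_def susp_cylinder_def)
  then show "g \<in> topspace (suspension X) \<rightarrow> topspace Y"
    using assms(2,3) by (auto simp: susp_carrier_def)
next
  fix U assume U: "openin Y U"
  have "{p \<in> topspace (susp_cylinder X). susp_map p \<in> {x \<in> susp_carrier X. g x \<in> U}}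
      = {p \<in> topspace (susp_cylinder X). (g \<circ> susp_map) p \<in> U}"
    using susp_map_in_carrier by auto
  then show "openin (suspension X) {x \<in> topspace (suspension X). g x \<in> U}"
    using assms(1) U by (auto simp: openin_suspension continuous_map_def)
qed

text \<open>The suspension parameter is kept as an extra coordinate, so injectivity of \<open>e\<close> suffices for
  injectivity of the embedding; \<open>sc\<close> is scalar multiplication and \<open>z\<close> the origin.\<close>

definition susp_embed :: "(real \<Rightarrow> 'b \<Rightarrow> 'b) \<Rightarrow> 'b \<Rightarrow> ('x \<Rightarrow> 'b) \<Rightarrow> 'x susp \<Rightarrow> 'b \<times> real" where
  "susp_embed sc z e p = (case p of South \<Rightarrow> (z, -1) | North \<Rightarrow> (z, 1)
     | Mid x t \<Rightarrow> (sc (1 - \<bar>t\<bar>) (e x), t))"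

lemma susp_embed_continuous:
  fixes sc :: "real \<Rightarrow> 'b::topological_space \<Rightarrow> 'b"
  assumes sc: "continuous_on UNIV (\<lambda>p. sc (fst p) (snd p))" "\<And>b. sc 0 b = z"
    and e: "continuous_map X euclidean e"
  shows "continuous_map (suspension X) euclidean (susp_embed sc z e)"
proof (rule continuous_map_from_suspension)
  have "continuous_map (susp_cylinder X) euclideanreal snd"
    unfolding susp_cylinder_def using continuous_map_snd continuous_map_into_fulltopology by blast
  moreover from this have "continuous_map (susp_cylinder X) euclideanreal (\<lambda>p. 1 - \<bar>snd p\<bar>)"
    by (intro continuous_intros)
  moreover have "continuous_map (susp_cylinder X) euclidean (\<lambda>p. e (fst p))"
    unfolding susp_cylinder_def using continuous_map_compose[OF continuous_map_fst e]
    by (simp add: comp_def)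
  ultimately have *: "continuous_map (susp_cylinder X) (prod_topology euclidean euclidean)
      (\<lambda>p. (1 - \<bar>snd p\<bar>, e (fst p)))" and s: "continuous_map (susp_cylinder X) euclideanreal snd"
    by (auto simp only: continuous_map_paired)
  have "continuous_map (susp_cylinder X) euclidean ((\<lambda>p. sc (fst p) (snd p)) \<circ> (\<lambda>p. (1 - \<bar>snd p\<bar>, e (fst p))))"
    by (rule continuous_map_compose[OF *]) (use sc(1) in simp)
  with s have "continuous_map (susp_cylinder X) (prod_topology euclidean euclidean)
      (\<lambda>p. (sc (1 - \<bar>snd p\<bar>) (e (fst p)), snd p))"
    by (simp only: continuous_map_paired comp_def fst_conv snd_conv)
  then show "continuous_map (susp_cylinder X) euclidean (susp_embed sc z e \<circ> susp_map)"
    unfolding prod_topology_euclidean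
    by (rule continuous_map_eq) (auto simp: susp_map_def susp_embed_def sc(2))
qed auto

lemma susp_embed_inj:
  assumes "\<And>c. c \<noteq> 0 \<Longrightarrow> inj (sc c)" "inj_on e (topspace X)"
  shows "inj_on (susp_embed sc z e) (topspace (suspension X))"
proof (rule inj_onI)
  fix p q
  assume pq: "p \<in> topspace (suspension X)" "q \<in> topspace (suspension X)"
    and eq: "susp_embed sc z e p = susp_embed sc z e q"
  have "x = y" if "x \<in> topspace X" "y \<in> topspace X" "-1 < t" "t < 1"
    "sc (1 - \<bar>t\<bar>) (e x) = sc (1 - \<bar>t\<bar>) (e y)" for x y t
  proof -
    have "1 - \<bar>t\<bar> \<noteq> 0" using that by auto
    then have "e x = e y" using assms(1) that(5) by (meson injD)
    then show ?thesis using assms(2) that by (meson inj_onD)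
  qed
  then show "p = q"
    using pq eq by (auto simp: susp_embed_def susp_carrier_def)
qed

lemma inj_fun_scale: "c \<noteq> 0 \<Longrightarrow> inj (fun_scale c)"
  by (auto simp: inj_def fun_scale_def fun_eq_iff)

lemma inj_pair_scale: "c \<noteq> 0 \<Longrightarrow> inj (pair_scale c)"
  using inj_fun_scale[of c] by (auto simp: inj_def pair_scale_def)

lemma continuous_on_fun_scale:
  assumes "continuous_on S c" "continuous_on S f"
  shows "continuous_on S (\<lambda>x. fun_scale (c x) (f x))"
  unfolding fun_scale_def
  by (rule continuous_on_coordinatewise_then_product, rule continuous_on_mult[OF assms(1)],
      rule continuous_on_product_then_coordinatewise[OF assms(2)])

lemma continuous_on_pair_scale:
  assumes "continuous_on S c" "continuous_on S f"
  shows "continuous_on S (\<lambda>x. pair_scale (c x) (f x))"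
  unfolding pair_scale_def
  by (intro continuous_on_Pair continuous_on_fun_scale continuous_on_fst continuous_on_snd
      continuous_on_mult assms)

lemma continuous_on_pair_mass:
  assumes "continuous_on S f"
  shows "continuous_on S (\<lambda>x. pair_mass K (f x))"
  unfolding pair_mass_def
  by (intro continuous_on_add continuous_on_mass continuous_on_fst continuous_on_snd
      continuous_on_rabs assms)

lemma fun_scale_simps [simp]:
  "fun_scale c (fun_scale d x) = fun_scale (c * d) x" "fun_scale 1 x = x"
  "fun_scale 0 x = (\<lambda>v. 0)" "fun_scale c (\<lambda>v. 0) = (\<lambda>v. 0)"
  by (auto simp: fun_scale_def mult.assoc)

lemma pair_scale_simps [simp]:
  "pair_scale c (pair_scale d p) = pair_scale (c * d) p" "pair_scale 1 p = p"
  "pair_scale 0 p = (\<lambda>v. 0, 0)"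
  by (auto simp: pair_scale_def)

lemma pair_mass_scale: "0 \<le> c \<Longrightarrow> pair_mass K (pair_scale c p) = c * pair_mass K p"
  by (simp add: pair_mass_def pair_scale_def mass_scale abs_mult algebra_simps)

lemma pair_scale_mem: "p \<in> cone_of K \<times> UNIV \<Longrightarrow> 0 \<le> c \<Longrightarrow> pair_scale c p \<in> cone_of K \<times> UNIV"
  by (auto simp: pair_scale_def cone_of_scale)

lemma pair_mass_nonneg: "p \<in> cone_of K \<times> UNIV \<Longrightarrow> 0 \<le> pair_mass K p"
  by (auto simp: pair_mass_def mass_nonneg)

lemma pair_mass_eq_0_iff:
  assumes "complex_on K" "p \<in> cone_of K \<times> UNIV"
  shows "pair_mass K p = 0 \<longleftrightarrow> p = (\<lambda>v. 0, 0)"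
proof -
  have "0 \<le> mass K (fst p)" using assms(2) by (auto intro: mass_nonneg)
  then have "pair_mass K p = 0 \<longleftrightarrow> mass K (fst p) = 0 \<and> snd p = 0"
    by (auto simp: pair_mass_def)
  then show ?thesis using mass_eq_0_iff[OF assms(1)] assms(2) by (auto simp: prod_eq_iff)
qed

text \<open>One abstract step serves both suspensions: \<open>A\<close> is a cone with apex
  \<open>z\<close>, scaling \<open>sc\<close> and homogeneous size \<open>N\<close>. It is first
  \<open>cone_of K\<close> with \<open>mass\<close>, then the product of that cone with a line, with
  \<open>pair_mass\<close>.\<close>

lemma susp_embed_image:
  fixes sc :: "real \<Rightarrow> 'b \<Rightarrow> 'b"
  assumes sc: "\<And>c d b. sc c (sc d b) = sc (c * d) b" "\<And>b. sc 1 b = b"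
    and N: "\<And>c b. 0 \<le> c \<Longrightarrow> N (sc c b) = c * N b" "\<And>b. b \<in> A \<Longrightarrow> 0 \<le> N b"
      "\<And>b. b \<in> A \<Longrightarrow> N b = 0 \<longleftrightarrow> b = z"
    and A: "\<And>c b. 0 \<le> c \<Longrightarrow> b \<in> A \<Longrightarrow> sc c b \<in> A" "z \<in> A"
    and e: "e ` topspace X = {b \<in> A. N b = 1}"
  shows "susp_embed sc z e ` topspace (suspension X) = {q. fst q \<in> A \<and> N (fst q) + \<bar>snd q\<bar> = 1}"
proof (intro equalityI subsetI)
  fix q assume "q \<in> susp_embed sc z e ` topspace (suspension X)"
  then obtain p where p: "p \<in> susp_carrier X" "q = susp_embed sc z e p" by auto
  have "N z = 0" using N(3) A(2) by blast
  moreover have "e x \<in> A" "N (e x) = 1" if "x \<in> topspace X" for x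
    using e that by blast+
  ultimately show "q \<in> {q. fst q \<in> A \<and> N (fst q) + \<bar>snd q\<bar> = 1}"
    using p A by (auto simp: susp_carrier_def susp_embed_def N(1))
next
  fix q assume "q \<in> {q. fst q \<in> A \<and> N (fst q) + \<bar>snd q\<bar> = 1}"
  then obtain b t where q: "q = (b, t)" "b \<in> A" "N b = 1 - \<bar>t\<bar>"
    by (metis (mono_tags, lifting) diff_eq_eq mem_Collect_eq prod.collapse)
  show "q \<in> susp_embed sc z e ` topspace (suspension X)"
  proof (cases "\<bar>t\<bar> = 1")
    case True
    then have "b = z" using q N(3) by auto
    moreover have "t = 1 \<or> t = -1" using True by linarith
    ultimately consider "q = susp_embed sc z e North" | "q = susp_embed sc z e South"
      using q by (auto simp: susp_embed_def)
    then show ?thesis by cases (auto simp: susp_carrier_def)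
  next
    case False
    then have t: "\<bar>t\<bar> < 1" using N(2)[OF q(2)] q(3) by linarith
    \<comment> \<open>Away from the poles \<open>N b = 1 - |t|\<close> is positive, so dividing by
      it undoes the shrinking towards the poles.\<close>
    let ?b = "sc (1 / (1 - \<bar>t\<bar>)) b"
    have "?b \<in> A" "N ?b = 1" using t q A(1) N(1) by auto
    then obtain x where x: "x \<in> topspace X" "e x = ?b"
      using e by (metis (mono_tags, lifting) imageE mem_Collect_eq)
    then have "q = susp_embed sc z e (Mid x t)"
      using t q by (simp add: susp_embed_def sc)
    moreover have "Mid x t \<in> topspace (suspension X)"
      using t x by (auto simp: susp_carrier_def)
    ultimately show ?thesis by blast
  qed
qed

lemma Hausdorff_space_sphere_of:
  fixes K :: "'a set set"
  shows "Hausdorff_space (top_of_set (sphere_of K))"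
proof -
  have "Hausdorff_space (prod_topology (prod_topology (euclidean :: ('a \<Rightarrow> real) topology) euclideanreal) euclideanreal)"
    by (simp only: Hausdorff_space_prod_topology Hausdorff_space_euclidean_fun Hausdorff_space_euclidean simp_thms)
  then show "Hausdorff_space (top_of_set (sphere_of K))"
    by (simp add: Hausdorff_space_subtopology)
qed

text \<open>The iterated embedding is a continuous bijection from a compact space onto a Hausdorff
  one, hence a homeomorphism without further work on the inverse.\<close>

lemma double_suspension_realization:
  assumes K: "complex_on K"
  shows "suspension (suspension (realization K)) homeomorphic_space top_of_set (sphere_of K)"
proof -
  let ?X = "realization K"
  let ?z = "\<lambda>v::'a. 0::real"
  let ?e = "susp_embed fun_scale ?z id"
  let ?f = "susp_embed pair_scale (?z, 0) ?e"
  have top: "topspace ?X = {x \<in> cone_of K. mass K x = 1}"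
    by (simp add: realization_eq[OF K])
  have fst_im: "?e ` topspace (suspension ?X) = {q. fst q \<in> cone_of K \<and> mass K (fst q) + \<bar>snd q\<bar> = 1}"
    by (rule susp_embed_image) (auto simp: mass_scale mass_nonneg mass_eq_0_iff[OF K] cone_of_scale top)
  \<comment> \<open>The first sphere is rewritten as the unit level of \<open>pair_mass\<close>, the
    form in which \<open>susp_embed_image\<close> takes its input the second time.\<close>
  have "{q. fst q \<in> cone_of K \<and> mass K (fst q) + \<bar>snd q\<bar> = 1}
      = {q \<in> cone_of K \<times> UNIV. pair_mass K q = 1}"
    by (auto simp: pair_mass_def)
  note fst_im' = fst_im[unfolded this]
  have im: "?f ` topspace (suspension (suspension ?X)) = sphere_of K"
    unfolding sphere_of_def
    by (rule susp_embed_image[OF _ _ _ _ _ _ _ fst_im'])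
      (simp_all add: pair_mass_scale pair_mass_nonneg pair_mass_eq_0_iff[OF K] pair_scale_mem
        del: mem_Sigma_iff, simp add: zero_in_cone_of)
  have c0: "continuous_map ?X euclidean id"
    by (simp add: realization_eq[OF K])
  have c1: "continuous_map (suspension ?X) euclidean ?e"
    by (rule susp_embed_continuous)
      (use c0 in \<open>auto intro!: continuous_on_fun_scale continuous_on_fst continuous_on_snd continuous_on_id\<close>)
  have c2: "continuous_map (suspension (suspension ?X)) euclidean ?f"
    by (rule susp_embed_continuous)
      (use c1 in \<open>auto intro!: continuous_on_pair_scale continuous_on_fst continuous_on_snd continuous_on_id\<close>)
  have inj: "inj_on ?f (topspace (suspension (suspension ?X)))"
    by (intro susp_embed_inj inj_pair_scale inj_fun_scale) auto
  have "Hausdorff_space (top_of_set (sphere_of K))" by (rule Hausdorff_space_sphere_of)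
  moreover have "continuous_map (suspension (suspension ?X)) (top_of_set (sphere_of K)) ?f"
    using c2 im by (auto simp: continuous_map_in_subtopology)
  ultimately have "homeomorphic_map (suspension (suspension ?X)) (top_of_set (sphere_of K)) ?f"
    using inj im
    by (intro continuous_imp_homeomorphic_map compact_space_suspension compact_space_realization K) auto
  then show ?thesis by (meson homeomorphic_map_imp_homeomorphic_space)
qed

section \<open>Homeomorphisms extend to one-point compactifications\<close>

lemma continuous_map_Alexandroff_compactification:
  assumes "homeomorphic_maps X Y f g"
  shows "continuous_map (Alexandroff_compactification X) (Alexandroff_compactification Y) (map_option f)"
  unfolding continuous_map_def
proof (intro conjI allI impI)
  have f: "f x \<in> topspace Y" if "x \<in> topspace X" for x
    using assms that by (auto simp: homeomorphic_maps_def continuous_map_def)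
  then show "map_option f \<in> topspace (Alexandroff_compactification X) \<rightarrow> topspace (Alexandroff_compactification Y)"
    by auto
  fix V assume "openin (Alexandroff_compactification Y) V"
  then consider U where "openin Y U" "V = Some ` U"
    | C where "compactin Y C" "closedin Y C" "V = insert None (Some ` (topspace Y - C))"
    by (auto simp: openin_Alexandroff_compactification)
  then show "openin (Alexandroff_compactification X)
      {x \<in> topspace (Alexandroff_compactification X). map_option f x \<in> V}"
  proof cases
    case (1 U)
    have "openin X {x \<in> topspace X. f x \<in> U}"
      using assms 1 by (auto simp: homeomorphic_maps_def continuous_map_def)
    moreover have "{x \<in> topspace (Alexandroff_compactification X). map_option f x \<in> V} = Some ` {x \<in> topspace X. f x \<in> U}"
      using 1 by auto
    ultimately show ?thesis by simp
  next
    case (2 C)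
    let ?D = "{x \<in> topspace X. f x \<in> C}"
    have "continuous_map X Y f" "continuous_map Y X g"
      using assms by (auto simp: homeomorphic_maps_def)
    have "C \<subseteq> topspace Y" using 2 closedin_subset by blast
    \<comment> \<open>Continuity at infinity asks for compact preimages of closed compact sets; the
      inverse \<open>g\<close> exhibits the preimage as a continuous image.\<close>
    then have "?D = g ` C"
    proof (intro equalityI subsetI)
      fix x assume "x \<in> ?D"
      then have "x = g (f x)" "f x \<in> C" using assms by (auto simp: homeomorphic_maps_def)
      then show "x \<in> g ` C" by blast
    next
      fix x assume "x \<in> g ` C"
      then obtain y where y: "y \<in> C" "x = g y" by blast
      then have "y \<in> topspace Y" using \<open>C \<subseteq> topspace Y\<close> by blast
      then have "g y \<in> topspace X" "f (g y) = y"
        using assms by (auto simp: homeomorphic_maps_def continuous_map_def)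
      with y show "x \<in> ?D" by simp
    qed
    then have "compactin X ?D"
      using image_compactin[OF 2(1) \<open>continuous_map Y X g\<close>] by simp
    moreover have "closedin X ?D"
      using closedin_continuous_map_preimage[OF \<open>continuous_map X Y f\<close> 2(2)] .
    moreover have "{x \<in> topspace (Alexandroff_compactification X). map_option f x \<in> V}
        = insert None (Some ` (topspace X - ?D))"
      using 2 f by auto
    ultimately show ?thesis by (auto simp: openin_Alexandroff_compactification)
  qed
qed

lemma homeomorphic_space_Alexandroff_compactification:
  assumes "X homeomorphic_space Y"
  shows "Alexandroff_compactification X homeomorphic_space Alexandroff_compactification Y"
proof -
  obtain f g where fg: "homeomorphic_maps X Y f g"
    using assms by (auto simp: homeomorphic_space_def)
  then have "homeomorphic_maps (Alexandroff_compactification X) (Alexandroff_compactification Y)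
      (map_option f) (map_option g)"
    using continuous_map_Alexandroff_compactification[OF fg]
      continuous_map_Alexandroff_compactification[OF homeomorphic_maps_sym[THEN iffD1, OF fg]]
    by (auto simp: homeomorphic_maps_def)
  then show ?thesis by (auto simp: homeomorphic_space_def)
qed

section \<open>Stereographic projection\<close>

text \<open>The point of height \<open>u\<close> on the sphere goes to radius \<open>m = (1 + u) / (1 - u)\<close>; the factors
  rescale a vector of size \<open>1 - |u|\<close> to size \<open>m\<close> and back.\<close>

definition stereo_inv :: "'a set set \<Rightarrow> ('a \<Rightarrow> real) \<times> real \<Rightarrow> (('a \<Rightarrow> real) \<times> real) \<times> real" where
  "stereo_inv K p = (let m = pair_mass K p in
     (pair_scale (2 / ((m + 1) * max 1 m)) p, (m - 1) / (m + 1)))"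

definition stereo :: "(('a \<Rightarrow> real) \<times> real) \<times> real \<Rightarrow> ('a \<Rightarrow> real) \<times> real" where
  "stereo q = pair_scale ((1 + max 0 (snd q)) / ((1 - snd q) * (1 - max 0 (snd q)))) (fst q)"

lemma Alexandroff_cone_times_line:
  assumes K: "complex_on K"
  shows "Alexandroff_compactification (top_of_set (cone_of K \<times> (UNIV :: real set)))
    homeomorphic_space top_of_set (sphere_of K)"
proof -
  let ?C = "cone_of K \<times> (UNIV :: real set)" and ?S = "sphere_of K"
  let ?N = "((\<lambda>v. 0, 0), 1) :: (('a \<Rightarrow> real) \<times> real) \<times> real"
  have N: "?N \<in> ?S" by (simp add: sphere_of_def pair_mass_def mass_def)
  have lt1: "snd q < 1" if "q \<in> ?S - {?N}" for q
  proof -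
    have q: "fst q \<in> ?C" "pair_mass K (fst q) + \<bar>snd q\<bar> = 1" "q \<noteq> ?N"
      using that by (auto simp: sphere_of_def)
    then have "snd q \<le> 1" using pair_mass_nonneg[OF q(1)] by linarith
    moreover have "snd q \<noteq> 1"
      using q pair_mass_eq_0_iff[OF K q(1)] by (auto simp: prod_eq_iff)
    ultimately show ?thesis by simp
  qed
  have "homeomorphic_maps (top_of_set ?C) (top_of_set (?S - {?N})) (stereo_inv K) stereo"
    unfolding homeomorphic_maps_def continuous_map_in_subtopology continuous_map_iff_continuous
      topspace_euclidean_subtopology
  proof (intro conjI ballI)
    have nz: "pair_mass K p + 1 \<noteq> 0" "max 1 (pair_mass K p) \<noteq> 0" if "p \<in> ?C" for p
      using pair_mass_nonneg[OF that] by linarith+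
    show "continuous_on ?C (stereo_inv K)"
      unfolding stereo_inv_def Let_def
      by (intro continuous_on_Pair continuous_on_pair_scale continuous_on_divide continuous_on_mult
          continuous_on_add continuous_on_diff continuous_on_max continuous_on_pair_mass
          continuous_on_const continuous_on_id)
        (use nz in auto)
    show "stereo_inv K \<in> ?C \<rightarrow> ?S - {?N}"
    proof
      fix p assume p: "p \<in> ?C"
      define m where "m = pair_mass K p"
      have m: "0 \<le> m" using p pair_mass_nonneg m_def by blast
      \<comment> \<open>The vector part gets size \<open>2 * m / ((m + 1) * max 1 m)\<close>. With
        \<open>u = (m - 1) / (m + 1)\<close> this is \<open>1 + u\<close> for \<open>m\<close> at
        most 1 and \<open>1 - u\<close> beyond, so \<open>1 - |u|\<close> in both cases.\<close>
      have "pair_mass K (fst (stereo_inv K p)) + \<bar>snd (stereo_inv K p)\<bar> = 1"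
        using m by (cases "m \<le> 1")
          (auto simp: stereo_inv_def Let_def pair_mass_scale max_def divide_simps simp flip: m_def,
            simp add: algebra_simps)
      moreover have "fst (stereo_inv K p) \<in> ?C"
        unfolding stereo_inv_def Let_def fst_conv m_def[symmetric]
        using p m by (intro pair_scale_mem) auto
      moreover have "snd (stereo_inv K p) \<noteq> 1"
        using m by (auto simp: stereo_inv_def Let_def divide_simps simp flip: m_def)
      ultimately show "stereo_inv K p \<in> ?S - {?N}"
        unfolding sphere_of_def by auto
    qed
    show "continuous_on (?S - {?N}) stereo"
      unfolding stereo_def
      by (intro continuous_on_pair_scale continuous_on_divide continuous_on_mult
          continuous_on_add continuous_on_diff continuous_on_max continuous_on_fst continuous_on_snd
          continuous_on_const continuous_on_id) (use lt1 in force)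
    show "stereo \<in> ?S - {?N} \<rightarrow> ?C"
    proof
      fix q assume q: "q \<in> ?S - {?N}"
      then have "fst q \<in> ?C" by (auto simp: sphere_of_def)
      then show "stereo q \<in> ?C"
        unfolding stereo_def by (intro pair_scale_mem) (use lt1[OF q] in auto)
    qed
    show "stereo (stereo_inv K p) = p" if p: "p \<in> ?C" for p
    proof -
      define m where "m = pair_mass K p"
      have m: "0 \<le> m" using p pair_mass_nonneg m_def by blast
      define u where "u = (m - 1) / (m + 1)"
      have u: "u \<le> 0 \<longleftrightarrow> m \<le> 1" "1 - u = 2 / (m + 1)" "1 + u = 2 * m / (m + 1)"
        using m by (auto simp: u_def divide_simps)
      have "(1 + max 0 u) / ((1 - u) * (1 - max 0 u)) * (2 / ((m + 1) * max 1 m)) = 1"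
      proof (cases "m \<le> 1")
        case True
        then have "max 0 u = 0" "max 1 m = 1" using u(1) by auto
        then show ?thesis using m by (simp add: u(2))
      next
        case False
        then have "max 0 u = u" "max 1 m = m" using u(1) by auto
        then show ?thesis
          using m False unfolding \<open>max 0 u = u\<close> \<open>max 1 m = m\<close> u(2,3) by (simp add: divide_simps)
      qed
      then show ?thesis
        unfolding stereo_def stereo_inv_def Let_def m_def[symmetric] fst_conv snd_conv u_def[symmetric]
        by (simp only: pair_scale_simps)
    qed
    show "stereo_inv K (stereo q) = q" if q: "q \<in> ?S - {?N}" for q
    proof -
      define u where "u = snd q"
      define f where "f = (1 + max 0 u) / ((1 - u) * (1 - max 0 u))"
      have u1: "u < 1" using lt1[OF q] u_def by simp
      then have f: "0 \<le> f" by (simp add: f_def)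
      have q': "fst q \<in> ?C" "pair_mass K (fst q) = 1 - \<bar>u\<bar>"
        using q by (auto simp: sphere_of_def u_def)
      then have "-1 \<le> u" using pair_mass_nonneg[OF q'(1)] by linarith
      define m where "m = (1 + u) / (1 - u)"
      have m1: "pair_mass K (stereo q) = f * (1 - \<bar>u\<bar>)"
        unfolding stereo_def u_def[symmetric] f_def[symmetric] by (simp add: pair_mass_scale f q'(2))
      \<comment> \<open>Here \<open>1 - |u|\<close> is \<open>1 + u\<close> or \<open>1 - u\<close>
        according to the sign, and in either case it cancels to leave
        \<open>(1 + u) / (1 - u)\<close>.\<close>
      have m2: "f * (1 - \<bar>u\<bar>) = m"
        using u1 by (cases "u \<le> 0") (auto simp: f_def m_def max_def divide_simps)
      have m: "m + 1 = 2 / (1 - u)" "(m - 1) / (m + 1) = u" "m \<le> 1 \<longleftrightarrow> u \<le> 0"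
        using u1 by (auto simp: m_def divide_simps)
      have "2 / ((m + 1) * max 1 m) * f = 1"
      proof (cases "u \<le> 0")
        case True
        then show ?thesis using u1 m(3) by (simp add: m(1) f_def max_def)
      next
        case False
        then have "max 1 m = m" "max 0 u = u" using m(3) by auto
        then show ?thesis using u1 False unfolding m(1) f_def by (simp add: m_def)
      qed
      then show ?thesis
        unfolding stereo_inv_def m1 m2 Let_def m(2)
        unfolding stereo_def u_def[symmetric] f_def[symmetric] pair_scale_simps
        by (simp only: pair_scale_simps) (simp add: u_def)
    qed
  qed
  then have 1: "top_of_set ?C homeomorphic_space top_of_set (?S - {?N})"
    by (auto simp: homeomorphic_space_def)
  have 2: "subtopology (top_of_set ?S) (topspace (top_of_set ?S) - {?N}) = top_of_set (?S - {?N})"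
    by (simp add: subtopology_subtopology Int_absorb1)
  have h: "suspension (suspension (realization K)) homeomorphic_space top_of_set ?S"
    by (rule double_suspension_realization[OF K])
  \<comment> \<open>The sphere inherits its compactness from the double suspension.\<close>
  have "compact_space (suspension (suspension (realization K)))"
    by (intro compact_space_suspension compact_space_realization K)
  then have "compact_space (top_of_set ?S)"
    using homeomorphic_compact_space[OF h] by simp
  moreover have "kc_space (top_of_set ?S)"
    by (intro Hausdorff_imp_kc_space Hausdorff_space_sphere_of)
  ultimately have 3: "Alexandroff_compactification (subtopology (top_of_set ?S) (topspace (top_of_set ?S) - {?N}))
      homeomorphic_space top_of_set ?S"
    by (intro Alexandroff_compactification_unique) (use N in auto)
  show ?thesis
    by (rule homeomorphic_space_trans[OF homeomorphic_space_Alexandroff_compactification[OF 1] 3[unfolded 2]])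
qed

section \<open>Spheres of isomorphic complexes\<close>

definition relabel :: "'b set \<Rightarrow> ('b \<Rightarrow> 'a) \<Rightarrow> ('a \<Rightarrow> real) \<Rightarrow> 'b \<Rightarrow> real" where
  "relabel W h x = (\<lambda>w. if w \<in> W then x (h w) else 0)"

lemma continuous_on_relabel:
  assumes "continuous_on S f"
  shows "continuous_on S (\<lambda>x. relabel W h (f x))"
  unfolding relabel_def
proof (rule continuous_on_coordinatewise_then_product)
  fix w
  show "continuous_on S (\<lambda>x. if w \<in> W then f x (h w) else 0)"
    using continuous_on_product_then_coordinatewise[OF assms] by (cases "w \<in> W") auto
qed

text \<open>Functions pull back, so \<open>h\<close> leads from the new vertices to the old ones.
  The support of the pullback is the preimage of the old support, which is why preimages of faces
  must be faces; bijectivity preserves the mass.\<close>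

lemma relabel_sphere_of:
  assumes h: "bij_betw h (\<Union>L) (\<Union>K)"
    and face: "\<And>F. F \<in> K \<Longrightarrow> {w \<in> \<Union>L. h w \<in> F} \<in> L"
    and q: "((x, t), u) \<in> sphere_of K"
  shows "((relabel (\<Union>L) h x, t), u) \<in> sphere_of L"
proof -
  have x: "x \<in> cone_of K" and m: "mass K x + \<bar>t\<bar> + \<bar>u\<bar> = 1"
    using q by (auto simp: sphere_of_def pair_mass_def)
  have "{w. relabel (\<Union>L) h x w \<noteq> 0} = {w \<in> \<Union>L. h w \<in> {v. x v \<noteq> 0}}"
    by (auto simp: relabel_def)
  moreover have "{w \<in> \<Union>L. h w \<in> {v. x v \<noteq> 0}} \<in> insert {} L"
  proof (cases "{v. x v \<noteq> 0} = {}")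
    case False
    then have "{v. x v \<noteq> 0} \<in> K" using x by (auto simp: cone_of_def)
    from face[OF this] show ?thesis by (rule insertI2)
  qed auto
  ultimately have "{w. relabel (\<Union>L) h x w \<noteq> 0} \<in> insert {} L" by (simp only:)
  moreover have "0 \<le> relabel (\<Union>L) h x w" for w
    using cone_of_nonneg[OF x] by (simp add: relabel_def)
  ultimately have "relabel (\<Union>L) h x \<in> cone_of L"
    unfolding cone_of_def by blast
  moreover have "mass L (relabel (\<Union>L) h x) = (\<Sum>w\<in>\<Union>L. x (h w))"
    unfolding mass_def by (intro sum.cong) (auto simp: relabel_def)
  then have "mass L (relabel (\<Union>L) h x) = mass K x"
    unfolding mass_def using sum.reindex_bij_betw[OF h, of x] by simp
  ultimately show ?thesis using m by (simp add: sphere_of_def pair_mass_def)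
qed

lemma simplicial_iso_sphere_of:
  assumes "simplicial_iso K L"
  shows "top_of_set (sphere_of K) homeomorphic_space top_of_set (sphere_of L)"
proof -
  obtain f where f: "bij_betw f (\<Union>K) (\<Union>L)" and KL: "(\<lambda>F. f ` F) ` K = L"
    using assms by (auto simp: simplicial_iso_def)
  define g where "g = inv_into (\<Union>K) f"
  have g: "bij_betw g (\<Union>L) (\<Union>K)" using f bij_betw_inv_into g_def by blast
  have gf: "g (f v) = v" if "v \<in> \<Union>K" for v
    using f that by (auto simp: g_def bij_betw_def)
  have fg: "f (g w) = w" if "w \<in> \<Union>L" for w
    using f that by (simp add: g_def bij_betw_inv_into_right)
  have face1: "{w \<in> \<Union>L. g w \<in> F} \<in> L" if "F \<in> K" for F
  proof -
    have "{w \<in> \<Union>L. g w \<in> F} = f ` F"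
    proof (intro equalityI subsetI)
      fix w assume "w \<in> f ` F"
      then obtain v where v: "v \<in> F" "w = f v" by blast
      then have "v \<in> \<Union>K" using that by blast
      then have "w \<in> \<Union>L" "g w = v" using v gf bij_betwE[OF f] by blast+
      with v show "w \<in> {w \<in> \<Union>L. g w \<in> F}" by simp
    qed (use fg in force)
    then show ?thesis using that KL by blast
  qed
  have face2: "{v \<in> \<Union>K. f v \<in> G} \<in> K" if G: "G \<in> L" for G
  proof -
    obtain F where F: "F \<in> K" "G = f ` F" using G unfolding KL[symmetric] by blast
    have "{v \<in> \<Union>K. f v \<in> G} = F"
    proof (intro equalityI subsetI)
      fix v assume "v \<in> {v \<in> \<Union>K. f v \<in> G}"
      then obtain v' where v': "v \<in> \<Union>K" "v' \<in> F" "f v = f v'" using F by auto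
      then have "v' \<in> \<Union>K" using F by blast
      then have "v = v'" using v' gf by metis
      then show "v \<in> F" using v' by simp
    qed (use F in auto)
    then show ?thesis using F by simp
  qed
  let ?R = "\<lambda>W h q. ((relabel W h (fst (fst q)), snd (fst q)), snd q)"
  have cont: "continuous_on S (?R W h)" for W :: "'c set" and h :: "'c \<Rightarrow> 'd" and S
    by (intro continuous_on_Pair continuous_on_relabel continuous_on_fst continuous_on_snd continuous_on_id)
  have inv: "relabel (\<Union>K) h (relabel (\<Union>L) k x) = x"
    if "x \<in> cone_of K" "\<And>v. v \<in> \<Union>K \<Longrightarrow> h v \<in> \<Union>L" "\<And>v. v \<in> \<Union>K \<Longrightarrow> k (h v) = v"
    for K :: "'c set set" and L :: "'d set set" and h k and x :: "'c \<Rightarrow> real"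
    using that cone_of_outside[OF that(1)] by (auto simp: relabel_def fun_eq_iff)
  have "homeomorphic_maps (top_of_set (sphere_of K)) (top_of_set (sphere_of L)) (?R (\<Union>L) g) (?R (\<Union>K) f)"
    unfolding homeomorphic_maps_def continuous_map_in_subtopology continuous_map_iff_continuous
      topspace_euclidean_subtopology
  proof (intro conjI ballI)
    show "?R (\<Union>L) g \<in> sphere_of K \<rightarrow> sphere_of L"
      using relabel_sphere_of[OF g face1] by auto
    show "?R (\<Union>K) f \<in> sphere_of L \<rightarrow> sphere_of K"
      using relabel_sphere_of[OF f face2] by auto
  next
    fix q assume "q \<in> sphere_of K"
    then have "fst (fst q) \<in> cone_of K" by (auto simp: sphere_of_def)
    then have "relabel (\<Union>K) f (relabel (\<Union>L) g (fst (fst q))) = fst (fst q)"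
      by (rule inv) (use bij_betwE[OF f] gf in blast)+
    then show "?R (\<Union>K) f (?R (\<Union>L) g q) = q" by simp
  next
    fix q assume "q \<in> sphere_of L"
    then have "fst (fst q) \<in> cone_of L" by (auto simp: sphere_of_def)
    then have "relabel (\<Union>L) g (relabel (\<Union>K) f (fst (fst q))) = fst (fst q)"
      by (rule inv) (use bij_betwE[OF g] fg in blast)+
    then show "?R (\<Union>L) g (?R (\<Union>K) f q) = q" by simp
  qed (rule cont)+
  then show ?thesis by (auto simp: homeomorphic_space_def)
qed

section \<open>Homotopy equivalence with the poset of closed faces\<close>

lemma homotopic_top_of_setI:
  fixes h :: "real \<times> 'a::topological_space \<Rightarrow> 'a"
  assumes "continuous_on ({0..1} \<times> S) h" "\<And>s x. s \<in> {0..1} \<Longrightarrow> x \<in> S \<Longrightarrow> h (s, x) \<in> S"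
    and "\<And>x. x \<in> S \<Longrightarrow> h (0, x) = f x" "\<And>x. x \<in> S \<Longrightarrow> h (1, x) = g x"
  shows "homotopic_with (\<lambda>x. True) (top_of_set S) (top_of_set S) f g"
proof -
  have "continuous_map (prod_topology (top_of_set {0..1}) (top_of_set S)) (top_of_set S) h"
    using assms(1,2) by (auto simp: continuous_map_in_subtopology)
  then show ?thesis
    by (subst homotopic_with) (use assms(3,4) in \<open>auto intro!: exI[of _ h]\<close>)
qed

lemma punctured_cone_homotopy_equivalent_sphere:
  assumes K: "complex_on K"
  shows "top_of_set (punctured_cone K) homotopy_equivalent_space top_of_set (sphere_of K)"
proof -
  let ?P = "punctured_cone K" and ?S = "sphere_of K"
  define sc where "sc c q = (pair_scale c (fst q), c * snd q)" for c and q :: "(('a \<Rightarrow> real) \<times> real) \<times> real"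
  define N where "N q = pair_mass K (fst q) + \<bar>snd q\<bar>" for q
  have N_sc: "N (sc c q) = c * N q" if "0 \<le> c" for c q
    using that by (simp add: N_def sc_def pair_mass_scale abs_mult distrib_left)
  have P: "q \<in> ?P \<longleftrightarrow> fst q \<in> cone_of K \<times> UNIV \<and> 0 < N q" for q
    using pair_mass_nonneg[of "fst q" K] by (auto simp: punctured_cone_def N_def)
  have S: "q \<in> ?S \<longleftrightarrow> fst q \<in> cone_of K \<times> UNIV \<and> N q = 1" for q
    by (simp add: sphere_of_def N_def)
  have sc_P: "sc c q \<in> ?P" if "0 < c" "q \<in> ?P" for c q
    using that pair_scale_mem[of "fst q" K c] unfolding P by (simp add: N_sc) (simp add: sc_def)
  have sc1: "sc 1 q = q" for q by (simp add: sc_def)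
  have cN: "continuous_on A (\<lambda>x. N (f x))" if "continuous_on A f" for f and A :: "'z::topological_space set"
    unfolding N_def
    by (intro continuous_on_add continuous_on_pair_mass continuous_on_fst continuous_on_snd
        continuous_on_rabs that)
  have csc: "continuous_on A (\<lambda>x. sc (c x) (f x))" if "continuous_on A c" "continuous_on A f"
    for c f and A :: "'z::topological_space set"
    unfolding sc_def
    by (intro continuous_on_Pair continuous_on_pair_scale continuous_on_mult continuous_on_fst continuous_on_snd that)
  define r where "r q = sc (1 / N q) q" for q
  have r_S: "r q \<in> ?S" if "q \<in> ?P" for q
    using sc_P[of "1 / N q" q] that unfolding P S r_def by (simp add: N_sc)
  have "homotopic_with (\<lambda>x. True) (top_of_set ?P) (top_of_set ?P) (id \<circ> r) id"
  proof (rule homotopic_top_of_setI)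
    \<comment> \<open>Only the scalar factor is interpolated: it runs linearly from
      \<open>1 / N q\<close> to 1 and stays positive, so the origin is avoided.\<close>
    let ?h = "\<lambda>p. sc ((1 - fst p) * (1 / N (snd p)) + fst p) (snd p)"
    show "continuous_on ({0..1} \<times> ?P) ?h"
      by (intro csc continuous_on_add continuous_on_mult continuous_on_diff continuous_on_divide cN
          continuous_on_fst continuous_on_snd continuous_on_const continuous_on_id) (auto simp: P)
    show "?h (s, q) \<in> ?P" if "s \<in> {0..1}" "q \<in> ?P" for s q
    proof -
      have N: "0 < 1 / N q" using that(2) P by simp
      have "0 < (1 - s) * (1 / N q) + s"
      proof (cases "s = 0")
        case False
        then have "0 < s" "0 \<le> (1 - s) * (1 / N q)" using that(1) N by auto
        then show ?thesis by linarith
      qed (use N in simp)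
      then show ?thesis using sc_P that(2) by simp
    qed
  qed (auto simp: r_def sc1)
  moreover have "retraction_maps (top_of_set ?P) (top_of_set ?S) r id"
    unfolding retraction_maps_def continuous_map_in_subtopology continuous_map_iff_continuous
      topspace_euclidean_subtopology
  proof (intro conjI ballI)
    show "continuous_on ?P r"
      unfolding r_def
      by (intro csc cN continuous_on_divide continuous_on_const continuous_on_id) (auto simp: P)
  qed (use r_S in \<open>auto simp: P S r_def sc1\<close>)
  ultimately show ?thesis
    by (rule deformation_retraction_imp_homotopy_equivalent_space)
qed

text \<open>Within a common face the segment stays in the cone. Nonnegative summands cannot cancel,
  so the segment meets the apex only if it starts from the apex, and the removed origin is never
  hit.\<close>

lemma straight_line_homotopy_punctured_cone:
  assumes K: "complex_on K" and f: "continuous_on (cone_of K) f" "f (\<lambda>v. 0) = (\<lambda>v. 0)"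
    and face: "\<And>x. x \<in> cone_of K \<Longrightarrow> x \<noteq> (\<lambda>v. 0) \<Longrightarrow>
      \<exists>F\<in>K. {v. x v \<noteq> 0} \<subseteq> F \<and> {v. f x v \<noteq> 0} \<subseteq> F"
    and pos: "\<And>x v. x \<in> cone_of K \<Longrightarrow> 0 \<le> f x v"
    and nz: "\<And>x. x \<in> cone_of K \<Longrightarrow> f x = (\<lambda>v. 0) \<Longrightarrow> x = (\<lambda>v. 0)"
  shows "homotopic_with (\<lambda>x. True) (top_of_set (punctured_cone K)) (top_of_set (punctured_cone K))
    (\<lambda>q. ((f (fst (fst q)), snd (fst q)), snd q)) id"
proof -
  let ?P = "punctured_cone K"
  define l where "l s x = (\<lambda>v. (1 - s) * f x v + s * x v)" for s x
  have l_cone: "l s x \<in> cone_of K" "l s x = (\<lambda>v. 0) \<Longrightarrow> x = (\<lambda>v. 0)"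
    if s: "s \<in> {0..1}" and x: "x \<in> cone_of K" for s x
  proof -
    have nonneg: "0 \<le> l s x v" for v
      using s pos[OF x, of v] cone_of_nonneg[OF x, of v] by (simp add: l_def)
    show "l s x \<in> cone_of K"
    proof (cases "x = (\<lambda>v. 0)")
      case True
      then show ?thesis using x by (simp add: l_def f(2))
    next
      case False
      then obtain F where F: "F \<in> K" "{v. x v \<noteq> 0} \<subseteq> F" "{v. f x v \<noteq> 0} \<subseteq> F"
        using face x by blast
      have "v \<in> F" if "l s x v \<noteq> 0" for v
      proof -
        have "x v \<noteq> 0 \<or> f x v \<noteq> 0" using that by (auto simp: l_def)
        then show ?thesis using F(2,3) by blast
      qed
      then show ?thesis by (rule cone_of_supportI[OF K F(1) nonneg])
    qed
    assume 0: "l s x = (\<lambda>v. 0)"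
    have "s * x v = 0" "(1 - s) * f x v = 0" for v
    proof -
      have "0 \<le> (1 - s) * f x v" "0 \<le> s * x v"
        using s pos[OF x, of v] cone_of_nonneg[OF x, of v] by simp_all
      moreover have "(1 - s) * f x v + s * x v = 0" using fun_cong[OF 0, of v] by (simp add: l_def)
      ultimately show "s * x v = 0" "(1 - s) * f x v = 0" by linarith+
    qed
    \<comment> \<open>For positive \<open>s\<close> the summand \<open>s * x v\<close> already
      forces \<open>x\<close> to vanish; at \<open>s = 0\<close> only \<open>f x\<close> is known to
      vanish, and \<open>nz\<close> takes over.\<close>
    then show "x = (\<lambda>v. 0)" using nz[OF x] by (cases "s = 0") (auto simp: fun_eq_iff)
  qed
  have P: "((x, t), u) \<in> ?P \<longleftrightarrow> x \<in> cone_of K \<and> \<not> (x = (\<lambda>v. 0) \<and> t = 0 \<and> u = 0)" for x t u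
    using pair_mass_nonneg[of "(x, t)" K] pair_mass_eq_0_iff[OF K, of "(x, t)"]
    by (auto simp: punctured_cone_def)
  show ?thesis
  proof (rule homotopic_top_of_setI)
    let ?h = "\<lambda>p::real \<times> (('a \<Rightarrow> real) \<times> real) \<times> real.
      ((l (fst p) (fst (fst (snd p))), snd (fst (snd p))), snd (snd p))"
    have 1: "continuous_on ({0..1} \<times> ?P) (\<lambda>p. f (fst (fst (snd p))))"
      by (rule continuous_on_compose2[OF f(1)])
        (auto intro!: continuous_on_fst continuous_on_snd continuous_on_id simp: P)
    have 2: "continuous_on ({0..1} \<times> ?P) (\<lambda>p. fst (fst (snd p)))"
      by (intro continuous_on_fst continuous_on_snd continuous_on_id)
    have "continuous_on ({0..1} \<times> ?P) (\<lambda>p. (1 - fst p) * f (fst (fst (snd p))) v + fst p * fst (fst (snd p)) v)" for v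
      by (intro continuous_on_add continuous_on_mult continuous_on_diff continuous_on_fst continuous_on_id
          continuous_on_const continuous_on_product_then_coordinatewise[OF 1]
          continuous_on_product_then_coordinatewise[OF 2])
    then have "continuous_on ({0..1} \<times> ?P) (\<lambda>p. l (fst p) (fst (fst (snd p))))"
      unfolding l_def by (rule continuous_on_coordinatewise_then_product)
    then show "continuous_on ({0..1} \<times> ?P) ?h"
      by (intro continuous_on_Pair continuous_on_fst continuous_on_snd continuous_on_id)
    show "?h (s, q) \<in> ?P" if "s \<in> {0..1}" "q \<in> ?P" for s q
    proof -
      obtain x t u where q: "q = ((x, t), u)" by (metis surj_pair)
      with that have "x \<in> cone_of K" "\<not> (x = (\<lambda>v. 0) \<and> t = 0 \<and> u = 0)" by (auto simp: P)
      then show ?thesis using l_cone[OF that(1)] unfolding q by (auto simp: P)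
    qed
  qed (auto simp: l_def)
qed

text \<open>As \<open>f\<close> and \<open>g\<close> vanish exactly at the apex, extending them by
  the identity on the two line coordinates keeps clear of the removed origin.\<close>

lemma punctured_cone_homotopy_equivalentI:
  assumes K: "complex_on K" and L: "complex_on L"
    and f: "continuous_on (cone_of K) f" "\<And>x. x \<in> cone_of K \<Longrightarrow> f x \<in> cone_of L"
      "\<And>x. x \<in> cone_of K \<Longrightarrow> f x = (\<lambda>v. 0) \<longleftrightarrow> x = (\<lambda>v. 0)"
    and g: "continuous_on (cone_of L) g" "\<And>x. x \<in> cone_of L \<Longrightarrow> g x \<in> cone_of K"
      "\<And>x. x \<in> cone_of L \<Longrightarrow> g x = (\<lambda>v. 0) \<longleftrightarrow> x = (\<lambda>v. 0)"
    and gf: "\<And>x. x \<in> cone_of K \<Longrightarrow> x \<noteq> (\<lambda>v. 0) \<Longrightarrow>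
      \<exists>F\<in>K. {v. x v \<noteq> 0} \<subseteq> F \<and> {v. g (f x) v \<noteq> 0} \<subseteq> F"
    and fg: "\<And>x. x \<in> cone_of L \<Longrightarrow> x \<noteq> (\<lambda>v. 0) \<Longrightarrow>
      \<exists>F\<in>L. {v. x v \<noteq> 0} \<subseteq> F \<and> {v. f (g x) v \<noteq> 0} \<subseteq> F"
  shows "top_of_set (punctured_cone K) homotopy_equivalent_space top_of_set (punctured_cone L)"
proof -
  let ?E = "\<lambda>f q. ((f (fst (fst q)), snd (fst q)), snd q)"
  have P: "((x, t), u) \<in> punctured_cone K \<longleftrightarrow> x \<in> cone_of K \<and> \<not> (x = (\<lambda>v. 0) \<and> t = 0 \<and> u = 0)"
    if "complex_on K" for x t u and K :: "'z set set"
    using pair_mass_nonneg[of "(x, t)" K] pair_mass_eq_0_iff[OF that, of "(x, t)"]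
    by (auto simp: punctured_cone_def)
  have cont: "continuous_map (top_of_set (punctured_cone K)) (top_of_set (punctured_cone L)) (?E f)"
    if "complex_on K" "complex_on L" "continuous_on (cone_of K) f" "\<And>x. x \<in> cone_of K \<Longrightarrow> f x \<in> cone_of L"
      "\<And>x. x \<in> cone_of K \<Longrightarrow> f x = (\<lambda>v. 0) \<longleftrightarrow> x = (\<lambda>v. 0)"
    for K :: "'y set set" and L :: "'z set set" and f
    unfolding continuous_map_in_subtopology continuous_map_iff_continuous topspace_euclidean_subtopology
  proof
    have "continuous_on (punctured_cone K) (\<lambda>q. f (fst (fst q)))"
      by (rule continuous_on_compose2[OF that(3)])
        (auto intro!: continuous_on_fst continuous_on_id simp: P[OF that(1)])
    then show "continuous_on (punctured_cone K) (?E f)"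
      by (intro continuous_on_Pair continuous_on_fst continuous_on_snd continuous_on_id)
    show "?E f \<in> punctured_cone K \<rightarrow> punctured_cone L"
      using that(4,5) by (auto simp: P[OF that(1)] P[OF that(2)])
  qed
  have "continuous_on (cone_of K) (\<lambda>x. g (f x))" "continuous_on (cone_of L) (\<lambda>x. f (g x))"
    using continuous_on_compose2[OF g(1) f(1)] continuous_on_compose2[OF f(1) g(1)] f(2) g(2) by blast+
  note fg_cont = this
  have "homotopic_with (\<lambda>x. True) (top_of_set (punctured_cone K)) (top_of_set (punctured_cone K))
    (?E (\<lambda>x. g (f x))) id"
    by (rule straight_line_homotopy_punctured_cone[OF K])
      (use fg_cont f(2,3) g(2,3) gf in \<open>auto intro: cone_of_nonneg\<close>)
  moreover have "homotopic_with (\<lambda>x. True) (top_of_set (punctured_cone L)) (top_of_set (punctured_cone L))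
    (?E (\<lambda>x. f (g x))) id"
    by (rule straight_line_homotopy_punctured_cone[OF L])
      (use fg_cont f(2,3) g(2,3) fg in \<open>auto intro: cone_of_nonneg\<close>)
  ultimately show ?thesis
    unfolding homotopy_equivalent_space_def
    using cont[OF K L f] cont[OF L K g]
    by (intro exI[of _ "?E f"] exI[of _ "?E g"]) (simp add: o_def)
qed

lemma continuous_on_Max_image:
  fixes f :: "'i \<Rightarrow> 'a::topological_space \<Rightarrow> 'b::linorder_topology"
  assumes "finite I" "I \<noteq> {}" "\<And>i. i \<in> I \<Longrightarrow> continuous_on S (f i)"
  shows "continuous_on S (\<lambda>x. Max ((\<lambda>i. f i x) ` I))"
  using assms
proof (induction I rule: finite_ne_induct)
  case (insert i I)
  then have "continuous_on S (\<lambda>x. max (f i x) (Max ((\<lambda>i. f i x) ` I)))"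
    by (intro continuous_on_max) auto
  then show ?case using insert by simp
qed simp

lemma continuous_on_Min_image:
  fixes f :: "'i \<Rightarrow> 'a::topological_space \<Rightarrow> 'b::linorder_topology"
  assumes "finite I" "I \<noteq> {}" "\<And>i. i \<in> I \<Longrightarrow> continuous_on S (f i)"
  shows "continuous_on S (\<lambda>x. Min ((\<lambda>i. f i x) ` I))"
  using assms
proof (induction I rule: finite_ne_induct)
  case (insert i I)
  then have "continuous_on S (\<lambda>x. min (f i x) (Min ((\<lambda>i. f i x) ` I)))"
    by (intro continuous_on_min) auto
  then show ?case using insert by simp
qed simp

text \<open>The sets in \<open>L\<close> play the role of the closed faces of \<open>K\<close>, the closure of a face being the
  smallest member of \<open>L\<close> above it.\<close>

locale face_cover =
  fixes K L :: "'a set set"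
  assumes complex: "complex_on K"
    and sub: "L \<subseteq> K"
    and cover: "\<And>F. F \<in> K \<Longrightarrow> \<exists>A\<in>L. F \<subseteq> A"
    and meet: "\<And>A B. A \<in> L \<Longrightarrow> B \<in> L \<Longrightarrow> A \<inter> B \<in> insert {} L"
begin

abbreviation OC :: "'a set set set" where
  "OC \<equiv> order_complex (\<subseteq>) L"

lemma finite_L: "finite L"
  using sub complex finite_subset by (auto simp: complex_on_def)

lemma finite_V: "finite (\<Union>K)"
  using complex by (rule complex_on_finite_vertices)

lemma L_nonempty: "A \<in> L \<Longrightarrow> A \<noteq> {}"
  using sub complex by (auto simp: complex_on_def)

lemma L_finite: "A \<in> L \<Longrightarrow> finite A"
  using sub complex by (auto simp: complex_on_def)

lemma OC_D: "c \<in> OC \<Longrightarrow> A \<in> c \<Longrightarrow> B \<in> c \<Longrightarrow> A \<subseteq> B \<or> B \<subseteq> A" "c \<in> OC \<Longrightarrow> c \<subseteq> L"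
  by (auto simp: order_complex_def Complete_Partial_Order.chain_def)

lemma OC_I: "c \<subseteq> L \<Longrightarrow> c \<noteq> {} \<Longrightarrow> (\<And>A B. A \<in> c \<Longrightarrow> B \<in> c \<Longrightarrow> A \<subseteq> B \<or> B \<subseteq> A) \<Longrightarrow> c \<in> OC"
  using finite_subset[of c L] finite_L
  by (simp add: order_complex_def Complete_Partial_Order.chain_def)

lemma complex_OC: "complex_on OC"
proof -
  have "OC \<subseteq> Pow L" by (auto simp: order_complex_def)
  then have "finite OC" using finite_L by (simp add: finite_subset)
  moreover have "G \<in> OC" if "F \<in> OC" "G \<subseteq> F" "G \<noteq> {}" for F G
  proof (rule OC_I[OF _ that(3)])
    show "G \<subseteq> L" using OC_D(2)[OF that(1)] that(2) by (rule order_trans[rotated])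
    show "A \<subseteq> B \<or> B \<subseteq> A" if "A \<in> G" "B \<in> G" for A B
      using OC_D(1)[OF \<open>F \<in> OC\<close>, of A B] \<open>G \<subseteq> F\<close> that by (meson subsetD)
  qed
  moreover have "finite F \<and> F \<noteq> {}" if "F \<in> OC" for F
    using that by (simp add: order_complex_def)
  ultimately show ?thesis unfolding complex_on_def by blast
qed

text \<open>The superlevel set \<open>{x \<ge> s}\<close> is contained in \<open>A\<close> iff \<open>s > outer_max A x\<close>. Hence \<open>weight x A\<close> is the
  length of the interval of levels \<open>s\<close> for which \<open>A\<close> is the closure of \<open>{x \<ge> s}\<close>.\<close>

definition outer_max :: "'a set \<Rightarrow> ('a \<Rightarrow> real) \<Rightarrow> real" where
  "outer_max A x = Max ((\<lambda>v. if v \<in> A then 0 else x v) ` \<Union>K)"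

definition weight :: "('a \<Rightarrow> real) \<Rightarrow> 'a set \<Rightarrow> real" where
  "weight x A = (if A \<in> L
     then max 0 (Min ((\<lambda>B. outer_max B x) ` {B \<in> insert {} L. B \<subset> A}) - outer_max A x) else 0)"

definition spread :: "('a set \<Rightarrow> real) \<Rightarrow> 'a \<Rightarrow> real" where
  "spread z v = (\<Sum>A\<in>{A \<in> L. v \<in> A}. z A)"

lemma outer_max_attained:
  assumes "L \<noteq> {}"
  obtains v where "v \<in> \<Union>K" "outer_max A x = (if v \<in> A then 0 else x v)"
proof -
  have "\<Union>K \<noteq> {}" using assms L_nonempty sub by blast
  then have "outer_max A x \<in> (\<lambda>v. if v \<in> A then 0 else x v) ` \<Union>K"
    unfolding outer_max_def using finite_V by (intro Max_in) auto
  then show ?thesis using that by blast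
qed

lemma outer_max_ge: "v \<in> \<Union>K \<Longrightarrow> v \<notin> A \<Longrightarrow> x v \<le> outer_max A x"
  unfolding outer_max_def using finite_V by (intro Max_ge) (auto intro!: image_eqI)

lemma outer_max_nonneg:
  assumes "L \<noteq> {}" "\<forall>v. 0 \<le> x v"
  shows "0 \<le> outer_max A x"
  by (rule outer_max_attained[OF assms(1), of A x]) (use assms(2) in simp)

lemma outer_max_mono:
  assumes "L \<noteq> {}" "\<forall>v. 0 \<le> x v" "A \<subseteq> B"
  shows "outer_max B x \<le> outer_max A x"
proof -
  obtain v where v: "v \<in> \<Union>K" "outer_max B x = (if v \<in> B then 0 else x v)"
    by (rule outer_max_attained[OF assms(1)])
  show ?thesis
  proof (cases "v \<in> B")
    case True
    then show ?thesis using v outer_max_nonneg[OF assms(1,2), of A] by simp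
  next
    case False
    then show ?thesis using v assms(3) outer_max_ge[of v A x] by auto
  qed
qed

text \<open>A vertex outside \<open>A \<inter> B\<close> is outside \<open>A\<close> or outside
  \<open>B\<close>. Together with \<open>meet\<close> this gives superlevel sets a well-defined
  closure.\<close>

lemma outer_max_Int:
  assumes "L \<noteq> {}" "\<forall>v. 0 \<le> x v"
  shows "outer_max (A \<inter> B) x = max (outer_max A x) (outer_max B x)"
proof (rule antisym)
  obtain v where v: "v \<in> \<Union>K" "outer_max (A \<inter> B) x = (if v \<in> A \<inter> B then 0 else x v)"
    by (rule outer_max_attained[OF assms(1)])
  show "outer_max (A \<inter> B) x \<le> max (outer_max A x) (outer_max B x)"
  proof (cases "v \<in> A \<inter> B")
    case True
    then show ?thesis using v outer_max_nonneg[OF assms, of A] by simp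
  next
    case False
    then show ?thesis using v outer_max_ge[of v A x] outer_max_ge[of v B x] by (cases "v \<in> A") auto
  qed
qed (use outer_max_mono[OF assms, of "A \<inter> B"] in auto)

lemma weight_nonneg: "0 \<le> weight x A"
  by (simp add: weight_def)

lemma weight_pos_iff:
  "weight x A \<noteq> 0 \<longleftrightarrow> A \<in> L \<and> (\<forall>B\<in>insert {} L. B \<subset> A \<longrightarrow> outer_max A x < outer_max B x)"
proof (cases "A \<in> L")
  case True
  let ?B = "{B \<in> insert {} L. B \<subset> A}"
  \<comment> \<open>The empty set always competes, since members of \<open>L\<close> are nonempty.
    It keeps \<open>Min\<close> meaningful, and as its \<open>outer_max\<close> is the largest value
    of \<open>x\<close>, levels with empty superlevel set are counted for no
    \<open>A\<close>.\<close>
  have "finite ?B" "{} \<in> ?B" using finite_L L_nonempty[OF True] by auto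
  then have "outer_max A x < Min ((\<lambda>B. outer_max B x) ` ?B) \<longleftrightarrow> (\<forall>B\<in>?B. outer_max A x < outer_max B x)"
    by (subst Min_gr_iff) auto
  moreover have "weight x A \<noteq> 0 \<longleftrightarrow> outer_max A x < Min ((\<lambda>B. outer_max B x) ` ?B)"
    using True by (auto simp: weight_def max_def)
  ultimately show ?thesis using True by blast
qed (simp add: weight_def)

lemma continuous_on_M:
  assumes "L \<noteq> {}"
  shows "continuous_on S (outer_max A)"
proof -
  have "\<Union>K \<noteq> {}" using assms L_nonempty sub by blast
  moreover have "continuous_on S (\<lambda>x. if v \<in> A then 0 else x v)" for v
    by (cases "v \<in> A") (simp_all add: continuous_on_coord)
  ultimately show ?thesis
    unfolding outer_max_def[abs_def] using finite_V by (intro continuous_on_Max_image)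
qed

lemma continuous_on_weight: "continuous_on S weight"
proof (rule continuous_on_coordinatewise_then_product)
  fix A
  show "continuous_on S (\<lambda>x. weight x A)"
  proof (cases "A \<in> L")
    case True
    let ?B = "{B \<in> insert {} L. B \<subset> A}"
    have B: "finite ?B" "?B \<noteq> {}" using finite_L L_nonempty[OF True] by auto
    have "L \<noteq> {}" using True by auto
    then have "continuous_on S (\<lambda>x. max 0 (Min ((\<lambda>B. outer_max B x) ` ?B) - outer_max A x))"
      by (intro continuous_on_max continuous_on_const continuous_on_diff continuous_on_M
          continuous_on_Min_image[OF B])
    then show ?thesis using True by (simp add: weight_def)
  qed (simp add: weight_def)
qed

lemma continuous_on_spread: "continuous_on S spread"
  unfolding spread_def[abs_def]
  by (rule continuous_on_coordinatewise_then_product, rule continuous_on_sum, rule continuous_on_coord)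

text \<open>Just above the level \<open>outer_max A x\<close> the superlevel set has closure
  \<open>A\<close>, and by assumption \<open>B\<close> contains that superlevel set too. Formally,
  intersecting with \<open>B\<close> does not raise \<open>outer_max\<close>, so
  \<open>A \<inter> B\<close> cannot be a proper subset of \<open>A\<close>.\<close>

lemma weight_subset:
  assumes x: "\<forall>v. 0 \<le> x v" and A: "weight x A \<noteq> 0" and B: "B \<in> L" "outer_max B x \<le> outer_max A x"
  shows "A \<subseteq> B"
proof (rule ccontr)
  have L: "A \<in> L" using A weight_pos_iff by blast
  then have "L \<noteq> {}" by blast
  assume "\<not> A \<subseteq> B"
  then have "A \<inter> B \<subset> A" by blast
  moreover have "A \<inter> B \<in> insert {} L" using L B meet by blast
  ultimately have "outer_max A x < outer_max (A \<inter> B) x" using A weight_pos_iff by blast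
  with B(2) show False by (simp add: outer_max_Int[OF \<open>L \<noteq> {}\<close> x])
qed

text \<open>The two values of \<open>outer_max\<close> are comparable real numbers, and the set with
  the larger value is the smaller set.\<close>

lemma weight_chain:
  assumes "\<forall>v. 0 \<le> x v" "weight x A \<noteq> 0" "weight x B \<noteq> 0"
  shows "A \<subseteq> B \<or> B \<subseteq> A"
proof -
  have "A \<in> L" "B \<in> L" using assms weight_pos_iff by blast+
  then show ?thesis
    using weight_subset[OF assms(1,2), of B] weight_subset[OF assms(1,3), of A] by linarith
qed

text \<open>A set containing the support has \<open>outer_max\<close> 0, the least possible value.
  Hence taking closures of superlevel sets never leaves a closed face that contains the support of
  \<open>x\<close>.\<close>

lemma weight_support:
  assumes x: "x \<in> cone_of K" "weight x A \<noteq> 0" and C: "C \<in> L" "{v. x v \<noteq> 0} \<subseteq> C"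
  shows "A \<subseteq> C"
proof -
  have nn: "\<forall>v. 0 \<le> x v" using x(1) by (simp add: cone_of_nonneg)
  have "L \<noteq> {}" using C by blast
  obtain v where "v \<in> \<Union>K" "outer_max C x = (if v \<in> C then 0 else x v)"
    by (rule outer_max_attained[OF \<open>L \<noteq> {}\<close>])
  then have "outer_max C x = 0" using C(2) by (auto split: if_splits)
  then show ?thesis using weight_subset[OF nn x(2) C(1)] outer_max_nonneg[OF \<open>L \<noteq> {}\<close> nn, of A] by simp
qed

lemma weight_in_cone:
  assumes x: "x \<in> cone_of K"
  shows "weight x \<in> cone_of OC"
proof -
  have nn: "\<forall>v. 0 \<le> x v" using x by (simp add: cone_of_nonneg)
  have "{A. weight x A \<noteq> 0} \<in> insert {} OC"
  proof (cases "{A. weight x A \<noteq> 0} = {}")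
    case False
    have "{A. weight x A \<noteq> 0} \<in> OC"
    proof (rule OC_I[OF _ False])
      show "{A. weight x A \<noteq> 0} \<subseteq> L" using weight_pos_iff by blast
    qed (use weight_chain[OF nn] in blast)
    then show ?thesis by (rule insertI2)
  qed simp
  then show ?thesis by (simp only: cone_of_def mem_Collect_eq weight_nonneg simp_thms)
qed

lemma weight_eq_0_iff:
  assumes x: "x \<in> cone_of K"
  shows "weight x = (\<lambda>A. 0) \<longleftrightarrow> x = (\<lambda>v. 0)"
proof
  assume x0: "x = (\<lambda>v. 0)"
  have "weight x A = 0" for A
  proof (rule ccontr)
    assume A: "weight x A \<noteq> 0"
    then have "A \<in> L" using weight_pos_iff by blast
    then have "{} \<subset> A" "L \<noteq> {}" using L_nonempty by auto
    moreover have "outer_max B x = 0" if "L \<noteq> {}" for B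
      by (rule outer_max_attained[OF that, of B x]) (simp add: x0)
    ultimately show False using A weight_pos_iff by (metis insertI1 less_irrefl)
  qed
  then show "weight x = (\<lambda>A. 0)" by blast
next
  assume w0: "weight x = (\<lambda>A. 0)"
  have nn: "\<forall>v. 0 \<le> x v" using x by (simp add: cone_of_nonneg)
  show "x = (\<lambda>v. 0)"
  proof (rule ccontr)
    assume "x \<noteq> (\<lambda>v. 0)"
    then obtain u where u: "x u \<noteq> 0" by blast
    then have supp: "{v. x v \<noteq> 0} \<in> K" using x by (auto simp: cone_of_def)
    then obtain C where C: "C \<in> L" "{v. x v \<noteq> 0} \<subseteq> C" using cover by blast
    then have "L \<noteq> {}" by blast
    have "u \<in> \<Union>K" using supp u by blast
    then have "0 < outer_max {} x" using outer_max_ge[of u "{}" x] spec[OF nn, of u] u by simp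
    moreover have "outer_max C x = 0"
      by (rule outer_max_attained[OF \<open>L \<noteq> {}\<close>, of C x]) (use C(2) in \<open>auto split: if_splits\<close>)
    \<comment> \<open>The covering set \<open>C\<close> has value 0, below the top value
      \<open>outer_max {} x\<close>. Among the members of \<open>L\<close> below the top value, one
      of least cardinality is not matched by any proper subset and so has nonzero weight.\<close>
    ultimately have "C \<in> {A \<in> L. outer_max A x < outer_max {} x}" using C by simp
    then obtain A where A: "A \<in> L" "outer_max A x < outer_max {} x"
      and min: "\<And>B. B \<in> L \<Longrightarrow> outer_max B x < outer_max {} x \<Longrightarrow> card A \<le> card B"
      using ex_min_if_finite[of "card ` {A \<in> L. outer_max A x < outer_max {} x}"] finite_L by fastforce
    have "outer_max A x < outer_max B x" if B: "B \<in> insert {} L" "B \<subset> A" for B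
    proof (rule ccontr)
      assume neg: "\<not> outer_max A x < outer_max B x"
      then have "outer_max B x < outer_max {} x" using A by simp
      then have "card A \<le> card B" using min B by auto
      then show False using psubset_card_mono[OF L_finite[OF A(1)] B(2)] by simp
    qed
    then have "weight x A \<noteq> 0" using A weight_pos_iff by blast
    then show False using w0 by simp
  qed
qed

lemma spread_nonzeroD:
  assumes "spread z v \<noteq> 0"
  obtains A where "A \<in> L" "v \<in> A" "z A \<noteq> 0"
proof -
  obtain A where "A \<in> {A \<in> L. v \<in> A}" "z A \<noteq> 0"
    using assms unfolding spread_def by (rule sum.not_neutral_contains_not_neutral)
  then show ?thesis by (intro that) auto
qed

lemma spread_ge:
  assumes "\<forall>A. 0 \<le> z A" "A \<in> L" "v \<in> A"
  shows "z A \<le> spread z v"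
  unfolding spread_def using assms finite_L by (intro member_le_sum) auto

lemma chain_has_top:
  assumes "c \<in> OC"
  obtains T where "T \<in> c" "T \<in> L" "\<And>A. A \<in> c \<Longrightarrow> A \<subseteq> T"
proof -
  have "finite c" "c \<noteq> {}" using assms by (auto simp: order_complex_def)
  then obtain T where T: "T \<in> c" "\<And>A. A \<in> c \<Longrightarrow> T \<subseteq> A \<Longrightarrow> T = A"
    using finite_has_maximal[of c] by metis
  then have "A \<subseteq> T" if "A \<in> c" for A using OC_D(1)[OF assms that T(1)] that by blast
  moreover have "T \<in> L" using T(1) OC_D(2)[OF assms] by blast
  ultimately show ?thesis using that T(1) by metis
qed

lemma spread_in_cone:
  assumes z: "z \<in> cone_of OC"
  shows "spread z \<in> cone_of K"
proof (cases "z = (\<lambda>A. 0)")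
  case True
  then have "spread z = (\<lambda>v. 0)" by (simp add: spread_def fun_eq_iff)
  then show ?thesis by simp
next
  case False
  then have "{A. z A \<noteq> 0} \<in> OC" using z by (auto simp: cone_of_def)
  then obtain T where T: "T \<in> L" "\<And>A. A \<in> {A. z A \<noteq> 0} \<Longrightarrow> A \<subseteq> T"
    by (rule chain_has_top) blast
  show ?thesis
  proof (rule cone_of_supportI[OF complex])
    show "T \<in> K" using T(1) sub by blast
    show "0 \<le> spread z v" for v
      unfolding spread_def by (intro sum_nonneg cone_of_nonneg[OF z])
    show "v \<in> T" if "spread z v \<noteq> 0" for v
      using spread_nonzeroD[OF that] T(2) by blast
  qed
qed

lemma spread_eq_0_iff:
  assumes z: "z \<in> cone_of OC"
  shows "spread z = (\<lambda>v. 0) \<longleftrightarrow> z = (\<lambda>A. 0)"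
proof
  assume s0: "spread z = (\<lambda>v. 0)"
  show "z = (\<lambda>A. 0)"
  proof
    fix A
    have nn: "\<forall>B. 0 \<le> z B" using z by (simp add: cone_of_nonneg)
    show "z A = 0"
    proof (cases "A \<in> L")
      case True
      then obtain v where "v \<in> A" using L_nonempty by blast
      then have "z A \<le> 0" using spread_ge[OF nn True] s0 by metis
      then show ?thesis using spec[OF nn, of A] by simp
    next
      case False
      then have "A \<notin> \<Union>OC" using OC_D(2) by blast
      then show ?thesis using cone_of_outside[OF z] by blast
    qed
  qed
qed (simp add: spread_def fun_eq_iff)

text \<open>On a chain member \<open>B\<close> the function \<open>spread z\<close> is at least as
  large as off \<open>B\<close>, so each of its superlevel sets contains \<open>B\<close> or lies in
  \<open>B\<close>. The two cases are told apart by comparing \<open>outer_max\<close>.\<close>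

lemma weight_spread_comparable:
  assumes z: "z \<in> cone_of OC" and A: "weight (spread z) A \<noteq> 0" and B: "z B \<noteq> 0"
  shows "A \<subseteq> B \<or> B \<subseteq> A"
proof -
  have nnz: "0 \<le> z C" for C using z by (rule cone_of_nonneg)
  have nn: "\<forall>v. 0 \<le> spread z v" using spread_in_cone[OF z] by (simp add: cone_of_nonneg)
  have supp: "{C. z C \<noteq> 0} \<in> OC" using z B by (auto simp: cone_of_def)
  then have BL: "B \<in> L" using OC_D(2) B by blast
  then have "L \<noteq> {}" by blast
  show ?thesis
  proof (cases "outer_max B (spread z) \<le> outer_max A (spread z)")
    case True
    then show ?thesis using weight_subset[OF nn A BL] by blast
  next
    case False
    have "v \<in> A" if v: "v \<in> B" for v
    proof (rule ccontr)
      assume "v \<notin> A"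
      moreover have "v \<in> \<Union>K" using v BL sub by blast
      ultimately have 1: "spread z v \<le> outer_max A (spread z)" by (intro outer_max_ge)
      obtain u where u: "u \<in> \<Union>K" "outer_max B (spread z) = (if u \<in> B then 0 else spread z u)"
        by (rule outer_max_attained[OF \<open>L \<noteq> {}\<close>])
      have "u \<notin> B" using u False outer_max_nonneg[OF \<open>L \<noteq> {}\<close> nn, of A] by (auto split: if_splits)
      have "spread z u \<le> spread z v"
      proof -
        \<comment> \<open>A chain member containing \<open>u\<close> does not lie in
          \<open>B\<close>, so it contains \<open>B\<close> and hence \<open>v\<close>: whatever
          contributes to the value at \<open>u\<close> also contributes at \<open>v\<close>.\<close>
        have "v \<in> C" if "C \<in> L" "u \<in> C" "z C \<noteq> 0" for C
          using OC_D(1)[OF supp, of B C] that B \<open>u \<notin> B\<close> v by blast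
        then have "(\<Sum>C\<in>{C \<in> L. u \<in> C}. z C) = (\<Sum>C\<in>{C \<in> L. u \<in> C \<and> v \<in> C}. z C)"
          using finite_L by (intro sum.mono_neutral_right) auto
        also have "\<dots> \<le> (\<Sum>C\<in>{C \<in> L. v \<in> C}. z C)"
          using finite_L nnz by (intro sum_mono2) auto
        finally show ?thesis by (simp add: spread_def)
      qed
      with 1 u \<open>u \<notin> B\<close> False show False by simp
    qed
    then show ?thesis by blast
  qed
qed

lemma punctured_cone_order_complex:
  "top_of_set (punctured_cone K) homotopy_equivalent_space top_of_set (punctured_cone OC)"
proof (rule punctured_cone_homotopy_equivalentI[OF complex complex_OC, where f = weight and g = spread])
  fix x assume x: "x \<in> cone_of K" "x \<noteq> (\<lambda>v. 0)"
  then have "{v. x v \<noteq> 0} \<in> K" by (auto simp: cone_of_def)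
  then obtain C where C: "C \<in> L" "{v. x v \<noteq> 0} \<subseteq> C" using cover by blast
  have "{v. spread (weight x) v \<noteq> 0} \<subseteq> C"
  proof
    fix v assume "v \<in> {v. spread (weight x) v \<noteq> 0}"
    then have "spread (weight x) v \<noteq> 0" by simp
    then obtain A where "v \<in> A" "weight x A \<noteq> 0" by (rule spread_nonzeroD)
    then show "v \<in> C" using weight_support[OF x(1) _ C] by blast
  qed
  then show "\<exists>F\<in>K. {v. x v \<noteq> 0} \<subseteq> F \<and> {v. spread (weight x) v \<noteq> 0} \<subseteq> F"
    using C sub by blast
next
  fix z assume z: "z \<in> cone_of OC" "z \<noteq> (\<lambda>A. 0)"
  let ?w = "weight (spread z)"
  have supp: "{A. z A \<noteq> 0} \<in> OC" using z by (auto simp: cone_of_def)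
  have nn: "\<forall>v. 0 \<le> spread z v" using spread_in_cone[OF z(1)] by (simp add: cone_of_nonneg)
  \<comment> \<open>Both chains together form one chain, which is the common face.\<close>
  have "{A. z A \<noteq> 0} \<union> {A. ?w A \<noteq> 0} \<in> OC"
  proof (rule OC_I)
    show "{A. z A \<noteq> 0} \<union> {A. ?w A \<noteq> 0} \<subseteq> L"
    proof (rule Un_least)
      show "{A. ?w A \<noteq> 0} \<subseteq> L" by (simp add: weight_pos_iff subset_iff)
    qed (rule OC_D(2)[OF supp])
    show "{A. z A \<noteq> 0} \<union> {A. ?w A \<noteq> 0} \<noteq> {}" using z by auto
    fix A B
    assume "A \<in> {A. z A \<noteq> 0} \<union> {A. ?w A \<noteq> 0}" "B \<in> {A. z A \<noteq> 0} \<union> {A. ?w A \<noteq> 0}"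
    then consider "z A \<noteq> 0" "z B \<noteq> 0" | "z A \<noteq> 0" "?w B \<noteq> 0"
      | "?w A \<noteq> 0" "z B \<noteq> 0" | "?w A \<noteq> 0" "?w B \<noteq> 0" by auto
    then show "A \<subseteq> B \<or> B \<subseteq> A"
    proof cases
      case 1
      then show ?thesis using OC_D(1)[OF supp, of A B] by simp
    next
      case 2
      then show ?thesis using weight_spread_comparable[OF z(1), of B A] by (simp add: disj_commute)
    next
      case 3
      then show ?thesis using weight_spread_comparable[OF z(1), of A B] by simp
    next
      case 4
      then show ?thesis by (rule weight_chain[OF nn])
    qed
  qed
  then show "\<exists>F\<in>OC. {v. z v \<noteq> 0} \<subseteq> F \<and> {v. weight (spread z) v \<noteq> 0} \<subseteq> F"
    by (intro bexI[of _ "{A. z A \<noteq> 0} \<union> {A. ?w A \<noteq> 0}"] conjI Un_upper1 Un_upper2)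
qed (simp_all add: continuous_on_weight continuous_on_spread weight_in_cone spread_in_cone
    weight_eq_0_iff spread_eq_0_iff)

end

section \<open>Compositions as sets of breaks\<close>

text \<open>The right ends of all blocks but the last. The bounds on \<open>k\<close> leave out the
  trivial partial sums 0 and \<open>n\<close>, so that break sets of compositions of
  \<open>n\<close> are faces on the vertices \<open>{1..<n}\<close>.\<close>

definition breaks :: "nat list \<Rightarrow> nat set" where
  "breaks a = {sum_list (take k a) | k. 0 < k \<and> k < length a}"

lemma sum_list_take_Suc: "k < length a \<Longrightarrow> sum_list (take (Suc k) a) = sum_list (take k a) + a ! k"
  by (simp add: take_Suc_conv_app_nth)

lemma sum_list_take_less:
  fixes a :: "nat list"
  assumes "0 \<notin> set a" "k < m" "m \<le> length a"
  shows "sum_list (take k a) < sum_list (take m a)"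
  using assms(2,3)
proof (induction m)
  case (Suc m)
  then have "0 < a ! m" using assms(1) by (metis Suc_le_lessD gr0I nth_mem)
  then have "sum_list (take m a) < sum_list (take (Suc m) a)"
    using Suc.prems by (simp add: sum_list_take_Suc)
  then show ?case using Suc by (cases "k = m") auto
qed simp

lemma sum_list_take_less_iff:
  fixes a :: "nat list"
  assumes "0 \<notin> set a" "k \<le> length a" "m \<le> length a"
  shows "sum_list (take k a) < sum_list (take m a) \<longleftrightarrow> k < m"
  using sum_list_take_less[OF assms(1), of k m] sum_list_take_less[OF assms(1), of m k] assms(2,3)
  by (cases k m rule: linorder_cases) auto

lemma breaks_subset:
  assumes "composition n a"
  shows "breaks a \<subseteq> {1..<n}"
proof
  fix i assume "i \<in> breaks a"
  then obtain k where k: "i = sum_list (take k a)" "0 < k" "k < length a" by (auto simp: breaks_def)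
  then show "i \<in> {1..<n}"
    using assms sum_list_take_less[of a 0 k] sum_list_take_less[of a k "length a"]
    by (auto simp: composition_def)
qed

lemma block_cover:
  assumes "composition n a" "j \<in> {1..n}"
  obtains k where "k < length a" "sum_list (take k a) < j" "j \<le> sum_list (take (Suc k) a)"
proof -
  let ?P = "\<lambda>k. j \<le> sum_list (take k a)"
  have P: "?P (length a)" using assms by (simp add: composition_def)
  define m where "m = (LEAST k. ?P k)"
  have m: "?P m" "m \<le> length a" unfolding m_def using LeastI[of ?P, OF P] Least_le[of ?P, OF P] by auto
  have "m \<noteq> 0" using m(1) assms(2) by (intro notI) simp
  then obtain k where k: "m = Suc k" by (cases m) auto
  have "\<not> ?P k" using not_less_Least[of k ?P] k unfolding m_def by simp
  then show ?thesis using that[of k] m k by simp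
qed

text \<open>Neighbours are separated only at the right end of a block. This identifies
  \<open>breaks\<close> as the inverse of \<open>comp_of\<close>.\<close>

lemma same_block_iff:
  assumes a: "composition n a" and i: "i \<in> {1..<n}"
  shows "(\<exists>B\<in>blocks a. i \<in> B \<and> Suc i \<in> B) \<longleftrightarrow> i \<notin> breaks a"
proof
  have a0: "0 \<notin> set a" using a by (simp add: composition_def)
  assume "\<exists>B\<in>blocks a. i \<in> B \<and> Suc i \<in> B"
  then obtain k where k: "k < length a" "sum_list (take k a) < i" "i < sum_list (take (Suc k) a)"
    by (auto simp: blocks_def)
  show "i \<notin> breaks a"
  proof
    assume "i \<in> breaks a"
    then obtain m where m: "i = sum_list (take m a)" "m < length a" by (auto simp: breaks_def)
    then have "k < m" "m < Suc k"
      using k sum_list_take_less_iff[OF a0, of k m] sum_list_take_less_iff[OF a0, of m "Suc k"] by auto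
    then show False by simp
  qed
next
  assume nb: "i \<notin> breaks a"
  have "i \<in> {1..n}" using i by simp
  then obtain k where k: "k < length a" "sum_list (take k a) < i" "i \<le> sum_list (take (Suc k) a)"
    by (rule block_cover[OF a])
  have "i \<noteq> sum_list (take (Suc k) a)"
  proof
    assume eq: "i = sum_list (take (Suc k) a)"
    then have "Suc k \<noteq> length a" using i a by (auto simp: composition_def)
    then show False using nb eq k(1) by (auto simp: breaks_def)
  qed
  then have "i \<in> {sum_list (take k a) + 1..sum_list (take (Suc k) a)}"
    "Suc i \<in> {sum_list (take k a) + 1..sum_list (take (Suc k) a)}"
    using k(2,3) by auto
  moreover have "{sum_list (take k a) + 1..sum_list (take (Suc k) a)} \<in> blocks a"
    using k(1) unfolding blocks_def by blast
  ultimately show "\<exists>B\<in>blocks a. i \<in> B \<and> Suc i \<in> B" by blast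
qed

lemma breaks_Cons: "breaks (x # xs) = (if xs = [] then {} else insert x ((+) x ` breaks xs))"
proof (cases "xs = []")
  case False
  have "i \<in> breaks (x # xs) \<longleftrightarrow> i \<in> insert x ((+) x ` breaks xs)" for i
  proof
    assume "i \<in> breaks (x # xs)"
    then obtain k where k: "i = sum_list (take k (x # xs))" "0 < k" "k < Suc (length xs)"
      by (auto simp: breaks_def)
    then obtain m where "k = Suc m" by (cases k) auto
    with k have m: "i = x + sum_list (take m xs)" "m < length xs" by auto
    show "i \<in> insert x ((+) x ` breaks xs)"
    proof (cases "m = 0")
      case False
      then have "sum_list (take m xs) \<in> breaks xs" using m by (auto simp: breaks_def)
      then show ?thesis using m by blast
    qed (use m in simp)
  next
    assume "i \<in> insert x ((+) x ` breaks xs)"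
    then consider "i = x" | k where "i = x + sum_list (take k xs)" "0 < k" "k < length xs"
      by (auto simp: breaks_def)
    then show "i \<in> breaks (x # xs)"
    proof cases
      case 1
      then have "i = sum_list (take 1 (x # xs))" "1 < length (x # xs)" using False by auto
      then show ?thesis unfolding breaks_def by blast
    next
      case 2
      then have "i = sum_list (take (Suc k) (x # xs))" "Suc k < length (x # xs)" by auto
      then show ?thesis unfolding breaks_def by blast
    qed
  qed
  then show ?thesis using False by auto
qed (auto simp: breaks_def)

lemma breaks_pos: "0 \<notin> set a \<Longrightarrow> i \<in> breaks a \<Longrightarrow> 0 < i"
  using breaks_subset[of "sum_list a" a] by (force simp: composition_def)

text \<open>The first part is the least break, every other break being that part plus something.
  Removing it and shifting back reduces the claim to the tails.\<close>

lemma breaks_inject: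
  assumes "composition n a" "composition n b" "breaks a = breaks b"
  shows "a = b"
  using assms
proof (induction a arbitrary: b n)
  case Nil
  then have "sum_list b = 0" "0 \<notin> set b" by (auto simp: composition_def)
  then show ?case by (cases b) auto
next
  case (Cons x xs)
  have x: "0 < x" "0 \<notin> set xs" "x + sum_list xs = n" using Cons.prems(1) by (auto simp: composition_def)
  with Cons.prems(2) obtain y ys where b: "b = y # ys" by (cases b) (auto simp: composition_def)
  have y: "0 < y" "0 \<notin> set ys" "y + sum_list ys = n" using Cons.prems(2) b by (auto simp: composition_def)
  show ?case
  proof (cases "xs = []")
    case True
    then have "ys = []" using Cons.prems(3) by (auto simp: b breaks_Cons split: if_splits)
    then show ?thesis using True x y b by simp
  next
    case False
    then have "ys \<noteq> []" using Cons.prems(3) by (auto simp: b breaks_Cons split: if_splits)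
    then have eq: "insert x ((+) x ` breaks xs) = insert y ((+) y ` breaks ys)"
      using Cons.prems(3) False by (simp add: b breaks_Cons)
    have "y \<le> x" using eq by (metis image_iff insertE insertI1 le_add1 order_refl)
    moreover have "x \<le> y" using eq by (metis image_iff insertE insertI1 le_add1 order_refl)
    ultimately have xy: "x = y" by simp
    have notin: "y \<notin> (+) y ` breaks xs" "y \<notin> (+) y ` breaks ys"
      using breaks_pos[OF x(2), of 0] breaks_pos[OF y(2), of 0] by auto
    have "(+) y ` breaks xs = (+) y ` breaks ys"
      using eq insert_ident[OF notin] unfolding xy by (rule iffD1[rotated])
    then have "breaks xs = breaks ys" by (simp add: inj_image_eq_iff)
    then have "xs = ys" using Cons.IH[of "sum_list xs" ys] x y xy by (simp add: composition_def)
    then show ?thesis using b xy by simp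
  qed
qed

lemma breaks_surj:
  assumes "G \<subseteq> {1..<n}"
  shows "\<exists>a. composition n a \<and> breaks a = G"
  using assms
proof (induction n arbitrary: G rule: less_induct)
  case (less n)
  show ?case
  proof (cases "G = {}")
    case True
    \<comment> \<open>For \<open>n = 0\<close> the list \<open>[0]\<close> would have a zero part,
      so the empty list is the witness.\<close>
    then show ?thesis
      by (intro exI[of _ "if n = 0 then [] else [n]"]) (auto simp: composition_def breaks_def)
  next
    case False
    have "finite G" using less.prems finite_subset by blast
    define m where "m = Min G"
    have m: "m \<in> G" "\<And>g. g \<in> G \<Longrightarrow> m \<le> g" using \<open>finite G\<close> False by (auto simp: m_def)
    then have m1: "1 \<le> m" "m < n" using less.prems by auto
    \<comment> \<open>The remaining breaks, measured from the first one as new origin.\<close>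
    let ?G = "(\<lambda>g. g - m) ` (G - {m})"
    have "?G \<subseteq> {1..<n - m}"
    proof
      fix i assume "i \<in> ?G"
      then obtain g where g: "g \<in> G" "g \<noteq> m" "i = g - m" by blast
      then have "m < g" "g < n" using m(2)[of g] less.prems by auto
      then show "i \<in> {1..<n - m}" using g by auto
    qed
    then obtain a where a: "composition (n - m) a" "breaks a = ?G"
      using less.IH[of "n - m" ?G] m1 by auto
    have "a \<noteq> []" using a(1) m1 by (auto simp: composition_def)
    then have "breaks (m # a) = insert m ((+) m ` ?G)" using a(2) by (simp add: breaks_Cons)
    also have "(+) m ` ?G = G - {m}"
      unfolding image_image using m(2) by (auto simp: image_iff)
    finally have "breaks (m # a) = G" using m(1) by (simp add: insert_absorb)
    moreover have "composition n (m # a)" using a(1) m1 by (auto simp: composition_def)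
    ultimately show ?thesis by blast
  qed
qed

lemma comp_of_breaks:
  assumes a: "composition n a"
  shows "comp_of n (breaks a) = a"
  unfolding comp_of_def
proof (rule the_equality)
  show "composition n a \<and> (\<forall>i\<in>{1..<n}. (\<exists>B\<in>blocks a. i \<in> B \<and> Suc i \<in> B) \<longleftrightarrow> i \<notin> breaks a)"
    using a same_block_iff[OF a] by blast
next
  fix b assume b: "composition n b \<and> (\<forall>i\<in>{1..<n}. (\<exists>B\<in>blocks b. i \<in> B \<and> Suc i \<in> B) \<longleftrightarrow> i \<notin> breaks a)"
  then have "\<forall>i\<in>{1..<n}. i \<in> breaks b \<longleftrightarrow> i \<in> breaks a" using same_block_iff[of n b] by blast
  then have "breaks b = breaks a" using breaks_subset[OF a] breaks_subset[of n b] b by blast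
  then show "b = a" using breaks_inject a b by blast
qed

lemma breaks_comp_of:
  assumes "G \<subseteq> {1..<n}"
  shows "composition n (comp_of n G)" "breaks (comp_of n G) = G"
  using breaks_surj[OF assms] comp_of_breaks by auto

section \<open>Refinement and joins in terms of break sets\<close>

lemma partition_on_blocks:
  assumes a: "composition n a"
  shows "partition_on {1..n} (blocks a)"
proof (rule partition_onI)
  have a0: "0 \<notin> set a" using a by (simp add: composition_def)
  show "\<Union>(blocks a) = {1..n}"
  proof (intro equalityI subsetI)
    fix j assume "j \<in> \<Union>(blocks a)"
    then obtain k where k: "k < length a" "sum_list (take k a) < j" "j \<le> sum_list (take (Suc k) a)"
      by (auto simp: blocks_def)
    have "sum_list (take (Suc k) a) \<le> n"
      using sum_list_take_less_iff[OF a0, of "length a" "Suc k"] k(1) a by (auto simp: composition_def)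
    then show "j \<in> {1..n}" using k by auto
  next
    fix j assume "j \<in> {1..n}"
    then obtain k where "k < length a" "sum_list (take k a) < j" "j \<le> sum_list (take (Suc k) a)"
      by (rule block_cover[OF a])
    then show "j \<in> \<Union>(blocks a)" unfolding blocks_def by force
  qed
  fix B C assume "B \<in> blocks a" "C \<in> blocks a" "B \<noteq> C"
  then obtain k m where km: "k < length a" "m < length a" "k \<noteq> m"
    "B = {sum_list (take k a) + 1..sum_list (take (Suc k) a)}"
    "C = {sum_list (take m a) + 1..sum_list (take (Suc m) a)}"
    unfolding blocks_def by blast
  have le: "sum_list (take (Suc p) a) \<le> sum_list (take q a)" if "p < q" "q < length a" for p q
    using sum_list_take_less_iff[OF a0, of q "Suc p"] that by auto
  show "disjnt B C"
  proof (cases "k < m")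
    case True
    then show ?thesis using km le[of k m] by (auto simp: disjnt_iff)
  next
    case False
    then show ?thesis using km le[of m k] by (auto simp: disjnt_iff)
  qed
next
  have a0: "0 \<notin> set a" using a by (simp add: composition_def)
  have "B \<noteq> {}" if B: "B \<in> blocks a" for B
  proof -
    obtain k where "k < length a" "B = {sum_list (take k a) + 1..sum_list (take (Suc k) a)}"
      using B by (auto simp: blocks_def)
    then show ?thesis using sum_list_take_less[OF a0, of k "Suc k"] by auto
  qed
  then show "{} \<notin> blocks a" by blast
qed

text \<open>Coarsening a composition amounts to deleting breaks, so the order is reversed.\<close>

lemma comp_le_iff_breaks:
  assumes a: "composition n a" and b: "composition n b"
  shows "comp_le n a b \<longleftrightarrow> breaks b \<subseteq> breaks a"
proof
  assume "comp_le n a b"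
  then have ref: "\<And>B. B \<in> blocks a \<Longrightarrow> \<exists>C\<in>blocks b. B \<subseteq> C"
    by (auto simp: comp_le_def refines_def)
  show "breaks b \<subseteq> breaks a"
  proof
    fix i assume i: "i \<in> breaks b"
    then have i': "i \<in> {1..<n}" using breaks_subset[OF b] by blast
    show "i \<in> breaks a"
    proof (rule ccontr)
      assume "i \<notin> breaks a"
      then obtain B where B: "B \<in> blocks a" "i \<in> B" "Suc i \<in> B"
        using same_block_iff[OF a i'] by auto
      then obtain C where "C \<in> blocks b" "B \<subseteq> C" using ref by auto
      then have "\<exists>C\<in>blocks b. i \<in> C \<and> Suc i \<in> C" using B by auto
      then show False using same_block_iff[OF b i'] i by simp
    qed
  qed
next
  assume sub: "breaks b \<subseteq> breaks a"
  have "\<exists>C\<in>blocks b. B \<subseteq> C" if B: "B \<in> blocks a" for B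
  proof -
    obtain l r where lr: "B = {l..r}" using B unfolding blocks_def by blast
    have B_sub: "B \<subseteq> {1..n}" "B \<noteq> {}"
      using partition_on_blocks[OF a] B by (auto simp: partition_on_def)
    then have "l \<in> {1..n}" "l \<le> r" "r \<le> n" using lr by auto
    then have "l \<in> \<Union>(blocks b)" using partition_onD1[OF partition_on_blocks[OF b]] by (simp only:)
    then obtain C where C: "C \<in> blocks b" "l \<in> C" by blast
    \<comment> \<open>Walk through \<open>B\<close> from its left end: no step inside
      \<open>B\<close> crosses a break of \<open>a\<close>, hence none crosses a break of
      \<open>b\<close>, and the walk stays in the block \<open>C\<close> where it began.\<close>
    have "i \<in> C" if "l \<le> i" "i \<le> r" for i
      using that
    proof (induction i rule: dec_induct)
      case (step i)
      then have i: "i \<in> {1..<n}" "i \<in> B" "Suc i \<in> B" using lr \<open>l \<in> {1..n}\<close> \<open>r \<le> n\<close> by auto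
      then have "i \<notin> breaks b" using same_block_iff[OF a i(1)] sub B by auto
      then obtain D where D: "D \<in> blocks b" "i \<in> D" "Suc i \<in> D"
        using same_block_iff[OF b i(1)] by auto
      moreover have "i \<in> C" using step by auto
      ultimately have "C = D"
        using partition_onD2[OF partition_on_blocks[OF b]] C(1) by (auto simp: disjoint_def)
      then show ?case using D by simp
    qed (use C in simp)
    then have "B \<subseteq> C" by (auto simp: lr)
    then show ?thesis using C(1) by (rule bexI)
  qed
  then show "comp_le n a b"
    using partition_on_blocks[OF a] partition_on_blocks[OF b] by (simp add: comp_le_def refines_def)
qed

text \<open>Under the order-reversing bijection with subsets of \<open>{1..<n}\<close>, least upper
  bounds become intersections.\<close>

lemma is_comp_join_iff_breaks:
  assumes S: "S \<noteq> {}" "\<And>a. a \<in> S \<Longrightarrow> composition n a"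
  shows "is_comp_join n S c \<longleftrightarrow> composition n c \<and> breaks c = (\<Inter>a\<in>S. breaks a)"
proof
  assume c: "is_comp_join n S c"
  then have cc: "composition n c" by (simp add: is_comp_join_def)
  have "(\<Inter>a\<in>S. breaks a) \<subseteq> {1..<n}" using S breaks_subset by blast
  then obtain d where d: "composition n d" "breaks d = (\<Inter>a\<in>S. breaks a)"
    using breaks_surj by blast
  have "comp_le n a d" if "a \<in> S" for a
    using comp_le_iff_breaks[OF S(2)[OF that] d(1)] d(2) that by auto
  then have "comp_le n c d" using c d(1) by (simp add: is_comp_join_def)
  then have "breaks d \<subseteq> breaks c" using comp_le_iff_breaks[OF cc d(1)] by simp
  moreover have "breaks c \<subseteq> breaks a" if "a \<in> S" for a
    using comp_le_iff_breaks[OF S(2)[OF that] cc] c that by (simp add: is_comp_join_def)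
  ultimately show "composition n c \<and> breaks c = (\<Inter>a\<in>S. breaks a)" using cc d(2) by auto
next
  assume c: "composition n c \<and> breaks c = (\<Inter>a\<in>S. breaks a)"
  show "is_comp_join n S c"
    unfolding is_comp_join_def
  proof (intro conjI ballI allI impI)
    show "comp_le n a c" if "a \<in> S" for a
      using comp_le_iff_breaks[OF S(2)[OF that], of c] c that by auto
    fix d assume d: "composition n d \<and> (\<forall>a\<in>S. comp_le n a d)"
    then have "breaks d \<subseteq> breaks a" if "a \<in> S" for a
      using comp_le_iff_breaks[OF S(2)[OF that], of d] that by blast
    then show "comp_le n c d" using comp_le_iff_breaks[of n c d] c d by auto
  qed (use c in simp)
qed

section \<open>Facets of \<open>delta\<close> and their intersections\<close>

definition type_breaks :: "nat \<Rightarrow> nat list \<Rightarrow> nat set set" where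
  "type_breaks n lam = breaks ` {a. composition n a \<and> has_type lam a}"

text \<open>The counterpart of \<open>C_poset\<close>: intersections of break sets correspond to
  joins, and dropping the empty set corresponds to dropping \<open>[n]\<close>, which has no
  breaks.\<close>

definition closed_faces :: "nat \<Rightarrow> nat list \<Rightarrow> nat set set" where
  "closed_faces n lam = {\<Inter>\<G> | \<G>. \<G> \<noteq> {} \<and> \<G> \<subseteq> type_breaks n lam} - {{}}"

lemma delta_eq: "delta n lam = {F. F \<noteq> {} \<and> (\<exists>G\<in>type_breaks n lam. F \<subseteq> G)}"
proof -
  have "G \<subseteq> {1..<n} \<and> has_type lam (comp_of n G) \<longleftrightarrow> G \<in> type_breaks n lam" for G
  proof
    assume G: "G \<subseteq> {1..<n} \<and> has_type lam (comp_of n G)"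
    then show "G \<in> type_breaks n lam"
      using breaks_comp_of[of G n] unfolding type_breaks_def by (metis (mono_tags, lifting) image_eqI mem_Collect_eq)
  next
    assume "G \<in> type_breaks n lam"
    then obtain a where "composition n a" "has_type lam a" "G = breaks a"
      by (auto simp: type_breaks_def)
    then show "G \<subseteq> {1..<n} \<and> has_type lam (comp_of n G)"
      using breaks_subset[of n a] comp_of_breaks[of n a] by simp
  qed
  then show ?thesis unfolding delta_def by blast
qed

lemma type_breaks_subset: "G \<in> type_breaks n lam \<Longrightarrow> G \<subseteq> {1..<n}"
  unfolding type_breaks_def using breaks_subset by blast

lemma complex_on_delta: "complex_on (delta n lam)"
proof -
  have "delta n lam \<subseteq> Pow {1..<n}" unfolding delta_def by blast
  then have "finite (delta n lam)" by (rule finite_subset) simp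
  moreover have "finite F" if "F \<in> delta n lam" for F
    using that \<open>delta n lam \<subseteq> Pow {1..<n}\<close> finite_subset[of F "{1..<n}"] by blast
  ultimately show ?thesis unfolding complex_on_def delta_eq by blast
qed

lemma face_cover_closed_faces: "face_cover (delta n lam) (closed_faces n lam)"
proof
  show "complex_on (delta n lam)" by (rule complex_on_delta)
  show "closed_faces n lam \<subseteq> delta n lam"
    unfolding closed_faces_def delta_eq by blast
  show "\<exists>A\<in>closed_faces n lam. F \<subseteq> A" if "F \<in> delta n lam" for F
  proof -
    obtain G where G: "F \<noteq> {}" "F \<subseteq> G" "G \<in> type_breaks n lam" using \<open>F \<in> delta n lam\<close> unfolding delta_eq by blast
    then have "\<Inter>{G} \<in> {\<Inter>\<G> | \<G>. \<G> \<noteq> {} \<and> \<G> \<subseteq> type_breaks n lam}" by blast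
    then have "G \<in> closed_faces n lam" using G unfolding closed_faces_def by auto
    then show ?thesis using G by blast
  qed
  show "A \<inter> B \<in> insert {} (closed_faces n lam)" if AB: "A \<in> closed_faces n lam" "B \<in> closed_faces n lam" for A B
  proof -
    obtain \<G> \<H> where "A = \<Inter>\<G>" "\<G> \<noteq> {}" "\<G> \<subseteq> type_breaks n lam"
      "B = \<Inter>\<H>" "\<H> \<subseteq> type_breaks n lam"
      using AB unfolding closed_faces_def by blast
    then have "A \<inter> B = \<Inter>(\<G> \<union> \<H>)" "\<G> \<union> \<H> \<noteq> {}" "\<G> \<union> \<H> \<subseteq> type_breaks n lam" by auto
    then show ?thesis unfolding closed_faces_def by blast
  qed
qed

lemma C_poset_composition: "c \<in> C_poset n lam \<Longrightarrow> composition n c"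
  by (auto simp: C_poset_def is_comp_join_def)

lemma breaks_C_poset:
  assumes "c \<in> C_poset n lam" "1 \<le> n"
  shows "breaks c \<in> closed_faces n lam"
proof -
  obtain S where S: "S \<noteq> {}" "S \<subseteq> {a. composition n a \<and> has_type lam a}" "is_comp_join n S c" "c \<noteq> [n]"
    using assms unfolding C_poset_def by blast
  then have c: "composition n c" "breaks c = \<Inter>(breaks ` S)"
    using is_comp_join_iff_breaks[of S n c] by auto
  have "breaks c \<noteq> {}"
  proof
    assume "breaks c = {}"
    \<comment> \<open>With two or more parts, the first part would be a break. The single-part
      composition \<open>[n]\<close> was excluded, and the empty list is ruled out by
      \<open>1 \<le> n\<close>.\<close>
    then have "length c \<le> 1"
      unfolding breaks_def by (metis (mono_tags, lifting) emptyE mem_Collect_eq not_le zero_less_one)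
    moreover have "breaks [n] = {}" by (auto simp: breaks_def)
    ultimately show False using c(1) S(4) assms(2)
      by (cases c) (auto simp: composition_def)
  qed
  moreover have "breaks ` S \<noteq> {}" "breaks ` S \<subseteq> type_breaks n lam"
    using S unfolding type_breaks_def by auto
  ultimately show ?thesis
    unfolding closed_faces_def c(2) by blast
qed

lemma C_poset_I:
  assumes "A \<in> closed_faces n lam"
  shows "\<exists>c\<in>C_poset n lam. breaks c = A"
proof -
  obtain \<G> where G: "A = \<Inter>\<G>" "\<G> \<noteq> {}" "\<G> \<subseteq> type_breaks n lam" "A \<noteq> {}"
    using assms unfolding closed_faces_def by blast
  define S where "S = {a. composition n a \<and> has_type lam a \<and> breaks a \<in> \<G>}"
  have SG: "breaks ` S = \<G>" using G(3) unfolding S_def type_breaks_def by auto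
  have S: "S \<noteq> {}" "S \<subseteq> {a. composition n a \<and> has_type lam a}" using SG G(2) unfolding S_def by auto
  have "A \<subseteq> {1..<n}" using G type_breaks_subset by blast
  then obtain c where c: "composition n c" "breaks c = A" using breaks_surj by blast
  then have "is_comp_join n S c" using is_comp_join_iff_breaks[of S n c] S SG G(1) by auto
  moreover have "c \<noteq> [n]" using c(2) G(4) by (auto simp: breaks_def)
  ultimately have "c \<in> C_poset n lam" unfolding C_poset_def using S by blast
  with c(2) show ?thesis by blast
qed

text \<open>The target carries reversed inclusion because coarser compositions have fewer breaks.
  Order complexes do not see the reversal.\<close>

lemma poset_iso_C_poset:
  assumes "1 \<le> n"
  shows "poset_iso (comp_le n) (C_poset n lam) (\<lambda>A B. B \<subseteq> A) (closed_faces n lam)"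
  unfolding poset_iso_def
proof (intro exI[of _ breaks] conjI ballI)
  show "bij_betw breaks (C_poset n lam) (closed_faces n lam)"
    unfolding bij_betw_def
  proof
    show "inj_on breaks (C_poset n lam)"
      using breaks_inject C_poset_composition by (meson inj_onI)
    show "breaks ` C_poset n lam = closed_faces n lam"
      using breaks_C_poset[OF _ assms] C_poset_I by blast
  qed
  show "comp_le n a b \<longleftrightarrow> breaks b \<subseteq> breaks a" if "a \<in> C_poset n lam" "b \<in> C_poset n lam" for a b
    using that C_poset_composition comp_le_iff_breaks by blast
qed

section \<open>Order complexes of isomorphic posets\<close>

lemma Union_order_complex:
  assumes "\<And>x. x \<in> P \<Longrightarrow> le x x"
  shows "\<Union>(order_complex le P) = P"
proof
  show "P \<subseteq> \<Union>(order_complex le P)"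
  proof
    fix x assume "x \<in> P"
    then have "{x} \<in> order_complex le P"
      using assms by (simp add: order_complex_def Complete_Partial_Order.chain_def)
    then show "x \<in> \<Union>(order_complex le P)" by blast
  qed
qed (auto simp: order_complex_def)

lemma order_complex_dual: "order_complex (\<lambda>x y. le y x) P = order_complex le P"
  by (auto simp: order_complex_def Complete_Partial_Order.chain_def)

text \<open>Reflexivity makes every singleton a chain, so the vertices of the order complex are
  precisely the elements of the poset, on which the isomorphism is a bijection.\<close>

lemma poset_iso_order_complex:
  assumes "poset_iso le P le' Q" and refl: "\<And>x. x \<in> P \<Longrightarrow> le x x"
  shows "simplicial_iso (order_complex le P) (order_complex le' Q)"
proof -
  obtain f where f: "bij_betw f P Q" "\<And>x y. x \<in> P \<Longrightarrow> y \<in> P \<Longrightarrow> le x y \<longleftrightarrow> le' (f x) (f y)"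
    using assms(1) unfolding poset_iso_def by blast
  have Q: "f ` P = Q" using f(1) by (simp add: bij_betw_def)
  have refl': "le' y y" if "y \<in> Q" for y
    using that refl f(2) unfolding Q[symmetric] by blast
  have chain: "Complete_Partial_Order.chain le' (f ` c) \<longleftrightarrow> Complete_Partial_Order.chain le c" if "c \<subseteq> P" for c
  proof -
    have "le x y \<longleftrightarrow> le' (f x) (f y)" if "x \<in> c" "y \<in> c" for x y
      using f(2) that \<open>c \<subseteq> P\<close> by blast
    then show ?thesis by (simp add: Complete_Partial_Order.chain_def)
  qed
  have fin: "finite (f ` c) \<longleftrightarrow> finite c" if "c \<subseteq> P" for c
    using f(1) that by (meson bij_betw_def finite_image_iff inj_on_subset)
  have "(\<lambda>F. f ` F) ` order_complex le P = order_complex le' Q"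
  proof (intro equalityI subsetI)
    fix d assume "d \<in> (\<lambda>F. f ` F) ` order_complex le P"
    then obtain c where c: "c \<in> order_complex le P" "d = f ` c" by blast
    then have "c \<subseteq> P" by (simp add: order_complex_def)
    then show "d \<in> order_complex le' Q"
      using c chain fin Q unfolding order_complex_def by blast
  next
    fix d assume d: "d \<in> order_complex le' Q"
    then have "d \<subseteq> f ` P" by (simp add: order_complex_def Q)
    then obtain c where c: "c \<subseteq> P" "d = f ` c" by (meson subset_imageE)
    then have "c \<in> order_complex le P"
      using d chain fin unfolding order_complex_def by blast
    then show "d \<in> (\<lambda>F. f ` F) ` order_complex le P" using c by blast
  qed
  then show ?thesis
    unfolding simplicial_iso_def
    using f(1) Union_order_complex[of P le, OF refl] Union_order_complex[of Q le', OF refl'] by auto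
qed

lemma finite_compositions: "finite {a. composition n a}"
proof (rule inj_on_finite[of breaks _ "Pow {1..<n}"])
  show "inj_on breaks {a. composition n a}"
    using breaks_inject by (auto intro: inj_onI)
  show "breaks ` {a. composition n a} \<subseteq> Pow {1..<n}"
    using breaks_subset by auto
qed simp

lemma finite_C_poset: "finite (C_poset n lam)"
  by (rule finite_subset[OF _ finite_compositions[of n]]) (auto dest: C_poset_composition)

lemma comp_le_refl: "composition n a \<Longrightarrow> comp_le n a a"
  by (simp add: comp_le_iff_breaks)

lemma complex_on_order_complex:
  assumes "finite P"
  shows "complex_on (order_complex le P)"
proof -
  have "order_complex le P \<subseteq> Pow P" by (auto simp: order_complex_def)
  then have "finite (order_complex le P)" by (rule finite_subset) (simp add: assms)
  moreover have "G \<in> order_complex le P" if "F \<in> order_complex le P" "G \<subseteq> F" "G \<noteq> {}" for F G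
    using that finite_subset[of G F]
    by (auto simp: order_complex_def Complete_Partial_Order.chain_def)
  moreover have "finite F \<and> F \<noteq> {}" if "F \<in> order_complex le P" for F
    using that by (simp add: order_complex_def)
  ultimately show ?thesis unfolding complex_on_def by blast
qed

section \<open>Strata in terms of roots and gaps\<close>

lemma homeomorphic_space_pullback:
  assumes "inj_on f A" "topspace T = UNIV"
  shows "pullback_topology A f T homeomorphic_space subtopology T (f ` A)"
proof -
  let ?P = "pullback_topology A f T"
  have top: "topspace ?P = A" by (simp add: topspace_pullback_topology assms(2))
  have "continuous_map ?P T (id \<circ> f)" by (intro continuous_map_pullback) simp
  then have "continuous_map ?P (subtopology T (f ` A)) f"
    using top by (simp add: continuous_map_in_subtopology)
  moreover have "open_map ?P (subtopology T (f ` A)) f"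
    unfolding open_map_def
  proof (intro allI impI)
    fix S assume "openin ?P S"
    then obtain U where U: "openin T U" "S = f -` U \<inter> A"
      by (auto simp: openin_pullback_topology)
    then have "f ` S = U \<inter> f ` A" by auto
    then show "openin (subtopology T (f ` A)) (f ` S)"
      using U(1) openin_subtopology by blast
  qed
  ultimately have "homeomorphic_map ?P (subtopology T (f ` A)) f"
    by (rule bijective_open_imp_homeomorphic_map) (use assms top in auto)
  then show ?thesis by (rule homeomorphic_map_imp_homeomorphic_space)
qed

lemma Hyp_homeomorphic_coeffs: "Hyp lam homeomorphic_space top_of_set (coeff ` hyp_polys lam)"
proof -
  have "inj_on coeff (hyp_polys lam)" by (auto intro: inj_onI simp: coeff_inject)
  then show ?thesis
    using homeomorphic_space_pullback[of coeff "hyp_polys lam" "powertop_real UNIV"]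
    by (simp add: Hyp_def euclidean_product_topology)
qed

section \<open>Monic polynomials given by their roots\<close>

definition roots_poly :: "nat \<Rightarrow> (nat \<Rightarrow> real) \<Rightarrow> real poly" where
  "roots_poly n r = (\<Prod>j<n. [:- r j, 1:])"

lemma roots_poly_monic: "degree (roots_poly n r) = n" "coeff (roots_poly n r) n = 1"
proof -
  have "degree (roots_poly n r) = n \<and> lead_coeff (roots_poly n r) = 1"
  proof (induction n)
    case (Suc n)
    have eq: "roots_poly (Suc n) r = roots_poly n r * [:- r n, 1:]" by (simp add: roots_poly_def)
    have "roots_poly n r \<noteq> 0" using Suc by auto
    then show ?case using Suc unfolding eq by (subst degree_mult_eq) (auto simp: lead_coeff_mult simp del: mult_pCons_right)
  qed (simp add: roots_poly_def)
  then show "degree (roots_poly n r) = n" "coeff (roots_poly n r) n = 1" by auto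
qed

lemma poly_roots_poly: "j < n \<Longrightarrow> poly (roots_poly n r) (r j) = 0"
  by (auto simp: roots_poly_def poly_prod)

lemma proots_roots_poly: "proots (roots_poly n r) = mset (map r [0..<n])"
proof (induction n)
  case (Suc n)
  have eq: "roots_poly (Suc n) r = roots_poly n r * [:- r n, 1:]" by (simp add: roots_poly_def)
  have "roots_poly n r \<noteq> 0" using roots_poly_monic(2)[of n r] by auto
  then have "proots (roots_poly (Suc n) r) = proots (roots_poly n r) + proots [:- r n, 1:]"
    unfolding eq by (intro proots_mult) auto
  then show ?case using Suc by simp
qed (simp add: roots_poly_def)

text \<open>The polynomial determines its multiset of roots, and a sorted list is determined by its
  multiset.\<close>

lemma roots_poly_inject:
  assumes "roots_poly n r = roots_poly n s"
    and "\<And>i j. i \<le> j \<Longrightarrow> j < n \<Longrightarrow> r i \<le> r j" "\<And>i j. i \<le> j \<Longrightarrow> j < n \<Longrightarrow> s i \<le> s j"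
    and "j < n"
  shows "r j = s j"
proof -
  have "mset (map r [0..<n]) = mset (map s [0..<n])"
    using assms(1) proots_roots_poly by metis
  moreover have "sorted (map r [0..<n])" "sorted (map s [0..<n])"
    using assms(2,3) by (auto simp: sorted_iff_nth_mono)
  ultimately have "map r [0..<n] = map s [0..<n]"
    by (metis properties_for_sort sorted_sort_id)
  then show ?thesis using assms(4) by simp
qed

lemma continuous_on_coeff_roots_poly:
  assumes "\<And>j. continuous_on S (\<lambda>x. r x j)"
  shows "continuous_on S (\<lambda>x. coeff (roots_poly n (r x)))"
proof (rule continuous_on_coordinatewise_then_product)
  fix k
  show "continuous_on S (\<lambda>x. coeff (roots_poly n (r x)) k)"
  proof (induction n arbitrary: k)
    case 0
    then show ?case by (simp add: roots_poly_def)
  next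
    case (Suc n)
    have eq: "coeff (roots_poly (Suc n) (r x)) k
      = - r x n * coeff (roots_poly n (r x)) k + (case k of 0 \<Rightarrow> 0 | Suc m \<Rightarrow> coeff (roots_poly n (r x)) m)" for x
    proof -
      have "roots_poly (Suc n) (r x) = [:- r x n, 1:] * roots_poly n (r x)"
        by (simp add: roots_poly_def mult.commute)
      then show ?thesis by (simp add: coeff_pCons split: nat.split)
    qed
    show ?case
      unfolding eq
    proof (intro continuous_on_add continuous_on_mult continuous_on_minus assms Suc)
      show "continuous_on S (\<lambda>x. case k of 0 \<Rightarrow> 0 | Suc m \<Rightarrow> coeff (roots_poly n (r x)) m)"
        by (cases k) (simp_all add: Suc)
    qed
  qed
qed

text \<open>If \<open>|x| > 1\<close>, the lower terms add up to at most
  \<open>n * b * |x| ^ (n - 1)\<close>; they must balance \<open>|x| ^ n\<close>, so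
  \<open>|x| \<le> n * b\<close>. The summand 1 covers the remaining \<open>x\<close>.\<close>

lemma root_bound:
  fixes p :: "real poly"
  assumes "degree p = n" "coeff p n = 1" "poly p x = 0" and b: "0 \<le> b" "\<And>k. k < n \<Longrightarrow> \<bar>coeff p k\<bar> \<le> b"
  shows "\<bar>x\<bar> \<le> 1 + real n * b"
proof (cases "\<bar>x\<bar> \<le> 1")
  case True
  then show ?thesis using b(1) by (simp add: add_increasing2)
next
  case False
  have "n \<noteq> 0"
  proof
    assume "n = 0"
    then have "poly p x = 1" using assms(1,2) by (simp add: poly_altdef)
    then show False using assms(3) by simp
  qed
  then obtain m where m: "n = Suc m" by (cases n) auto
  have "0 = (\<Sum>i\<le>n. coeff p i * x ^ i)" using assms(1,3) by (simp add: poly_altdef)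
  also have "\<dots> = (\<Sum>i<n. coeff p i * x ^ i) + x ^ n"
    using assms(2) by (simp add: lessThan_Suc_atMost[symmetric])
  finally have "\<bar>x\<bar> ^ n = \<bar>\<Sum>i<n. coeff p i * x ^ i\<bar>"
    by (simp add: power_abs[symmetric])
  also have "\<dots> \<le> (\<Sum>i<n. \<bar>coeff p i * x ^ i\<bar>)" by (rule sum_abs)
  also have "\<dots> \<le> (\<Sum>i<n. b * \<bar>x\<bar> ^ m)"
  proof (rule sum_mono)
    fix i assume i: "i \<in> {..<n}"
    then have "\<bar>x\<bar> ^ i \<le> \<bar>x\<bar> ^ m" using False m by (intro power_increasing) auto
    then show "\<bar>coeff p i * x ^ i\<bar> \<le> b * \<bar>x\<bar> ^ m"
      unfolding abs_mult power_abs using i b by (intro mult_mono) auto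
  qed
  also have "\<dots> = real n * b * \<bar>x\<bar> ^ m" by simp
  finally have "\<bar>x\<bar> * \<bar>x\<bar> ^ m \<le> (real n * b) * \<bar>x\<bar> ^ m" using m by simp
  then have "\<bar>x\<bar> \<le> real n * b"
    using False by (simp only: mult_le_cancel_right) (smt (verit) zero_less_power)
  then show ?thesis by simp
qed

text \<open>Roots are numbered from 0, so gap \<open>i\<close> lies between the \<open>i\<close>-th
  smallest root and the next one. This is the same convention as for a break at
  \<open>i\<close>.\<close>

definition roots_of_gaps :: "(nat \<Rightarrow> real) \<times> real \<Rightarrow> nat \<Rightarrow> real" where
  "roots_of_gaps p j = snd p + (\<Sum>i\<in>{1..j}. fst p i)"

lemma roots_of_gaps_Suc: "roots_of_gaps p (Suc j) = roots_of_gaps p j + fst p (Suc j)"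
  by (simp add: roots_of_gaps_def)

lemma roots_of_gaps_mono:
  assumes "\<And>i. 0 \<le> fst p i" "i \<le> j"
  shows "roots_of_gaps p i \<le> roots_of_gaps p j"
  using assms(2) by (induction j rule: dec_induct) (use assms(1) in \<open>auto simp: roots_of_gaps_Suc add_increasing2\<close>)

lemma hyp_polys_mset:
  assumes "mset b = mset lam"
  shows "hyp_polys b \<subseteq> hyp_polys lam"
proof
  fix p assume "p \<in> hyp_polys b"
  then obtain y where p: "p = (\<Prod>i<length b. [:- y i, 1:] ^ (b ! i))" by (auto simp: hyp_polys_def)
  obtain f where f: "bij_betw f {..<length lam} {..<length b}" "\<forall>i<length lam. lam ! i = b ! f i"
    using permutation_Ex_bij[of lam b] assms by auto
  have "(\<Prod>i<length lam. [:- (y \<circ> f) i, 1:] ^ (lam ! i)) = (\<Prod>i<length lam. [:- y (f i), 1:] ^ (b ! f i))"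
    using f(2) by (intro prod.cong) auto
  also have "\<dots> = p" unfolding p by (rule prod.reindex_bij_betw[OF f(1)])
  finally show "p \<in> hyp_polys lam" unfolding hyp_polys_def by blast
qed

lemma prod_blocks:
  fixes h :: "nat \<Rightarrow> 'a::comm_monoid_mult"
  assumes "m \<le> length b"
    and "\<And>k j. k < length b \<Longrightarrow> sum_list (take k b) \<le> j \<Longrightarrow> j < sum_list (take (Suc k) b) \<Longrightarrow>
      h j = h (sum_list (take k b))"
  shows "(\<Prod>j<sum_list (take m b). h j) = (\<Prod>k<m. h (sum_list (take k b)) ^ (b ! k))"
  using assms(1)
proof (induction m)
  case (Suc m)
  let ?s = "sum_list (take m b)"
  have s: "sum_list (take (Suc m) b) = ?s + b ! m"
    using Suc.prems by (simp add: take_Suc_conv_app_nth)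
  have "(\<Prod>j<?s + b ! m. h j) = (\<Prod>j<?s. h j) * (\<Prod>j\<in>{?s..<?s + b ! m}. h j)"
    by (subst prod.union_disjoint[symmetric]) (auto intro!: prod.cong)
  also have "(\<Prod>j\<in>{?s..<?s + b ! m}. h j) = (\<Prod>j\<in>{?s..<?s + b ! m}. h ?s)"
  proof (intro prod.cong refl)
    fix j assume "j \<in> {?s..<?s + b ! m}"
    then show "h j = h ?s" using Suc.prems s by (intro assms(2)) auto
  qed
  also have "\<dots> = h ?s ^ (b ! m)" by simp
  finally show ?case using Suc unfolding s by simp
qed simp

lemma not_in_breaks:
  assumes b: "composition n b" and k: "k < length b" "sum_list (take k b) < i" "i < sum_list (take (Suc k) b)"
  shows "i \<notin> breaks b"
proof
  have b0: "0 \<notin> set b" using b by (simp add: composition_def)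
  assume "i \<in> breaks b"
  then obtain m where m: "i = sum_list (take m b)" "m < length b" by (auto simp: breaks_def)
  then have "k < m" "m < Suc k"
    using k sum_list_take_less_iff[OF b0, of k m] sum_list_take_less_iff[OF b0, of m "Suc k"] by auto
  then show False by simp
qed

text \<open>Without a break there is no gap, so the root is constant along each block and the length
  of the block becomes its exponent.\<close>

lemma roots_poly_blocks:
  assumes b: "composition n b" and supp: "{i. fst p i \<noteq> 0} \<subseteq> breaks b"
  shows "roots_poly n (roots_of_gaps p)
    = (\<Prod>k<length b. [:- roots_of_gaps p (sum_list (take k b)), 1:] ^ (b ! k))"
proof -
  have const: "roots_of_gaps p j = roots_of_gaps p (sum_list (take k b))"
    if k: "k < length b" and j: "sum_list (take k b) \<le> j" "j < sum_list (take (Suc k) b)" for k j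
    using j
  proof (induction j rule: dec_induct)
    case (step j)
    then have "Suc j \<notin> breaks b" by (intro not_in_breaks[OF b k]) auto
    then have "fst p (Suc j) = 0" using supp by blast
    then show ?case using step by (simp add: roots_of_gaps_Suc)
  qed simp
  have "(\<Prod>j<sum_list (take (length b) b). [:- roots_of_gaps p j, 1:])
    = (\<Prod>k<length b. [:- roots_of_gaps p (sum_list (take k b)), 1:] ^ (b ! k))"
  proof (rule prod_blocks[OF order_refl])
    fix k j
    assume "k < length b" "sum_list (take k b) \<le> j" "j < sum_list (take (Suc k) b)"
    then have "roots_of_gaps p j = roots_of_gaps p (sum_list (take k b))" by (rule const)
    then show "[:- roots_of_gaps p j, 1:] = [:- roots_of_gaps p (sum_list (take k b)), 1:]" by simp
  qed
  then show ?thesis using b by (simp add: roots_poly_def composition_def)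
qed

lemma roots_poly_in_hyp_polys:
  assumes "number_partition n lam" "fst p \<in> cone_of (delta n lam)"
  shows "roots_poly n (roots_of_gaps p) \<in> hyp_polys lam"
proof -
  obtain b where b: "composition n b" "mset b = mset lam" "{i. fst p i \<noteq> 0} \<subseteq> breaks b"
  proof (cases "{i. fst p i \<noteq> 0} = {}")
    case True
    \<comment> \<open>With all gaps zero there is a single root of multiplicity \<open>n\<close>;
      any composition of the right type will do, for instance \<open>lam\<close> itself.\<close>
    have "composition n lam" using assms(1) by (simp add: composition_def number_partition_def)
    then show ?thesis using that[of lam] True by simp
  next
    case False
    then have "{i. fst p i \<noteq> 0} \<in> delta n lam" using assms(2) by (auto simp: cone_of_def)
    then obtain G where "G \<in> type_breaks n lam" "{i. fst p i \<noteq> 0} \<subseteq> G" unfolding delta_eq by blast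
    then show ?thesis using that unfolding type_breaks_def has_type_def by blast
  qed
  have "roots_poly n (roots_of_gaps p) \<in> hyp_polys b"
    unfolding roots_poly_blocks[OF b(1,3)] hyp_polys_def
    by (intro CollectI exI[of _ "\<lambda>k. roots_of_gaps p (sum_list (take k b))"]) simp
  then show ?thesis using hyp_polys_mset[OF b(2)] by blast
qed

text \<open>Sort the indices by root and let the multiplicities follow. Ties are allowed: roots that
  coincide merely produce zero gaps.\<close>

lemma hyp_polys_sorted:
  assumes "p \<in> hyp_polys lam"
  obtains b z where "mset b = mset lam" "p = (\<Prod>k<length b. [:- z k, 1:] ^ (b ! k))"
    "\<forall>i j. i \<le> j \<longrightarrow> j < length b \<longrightarrow> z i \<le> z j"
proof -
  let ?t = "length lam"
  obtain y where p: "p = (\<Prod>i<?t. [:- y i, 1:] ^ (lam ! i))"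
    using assms by (auto simp: hyp_polys_def)
  define idx where "idx = sort_key y [0..<?t]"
  have len: "length idx = ?t" by (simp add: idx_def)
  define b where "b = map ((!) lam) idx"
  have "mset b = image_mset ((!) lam) (mset [0..<?t])" by (simp add: b_def idx_def)
  also have "\<dots> = mset (map ((!) lam) [0..<?t])" by (simp only: mset_map)
  finally have mb: "mset b = mset lam" by (simp only: map_nth)
  have "bij_betw ((!) idx) {..<?t} {..<?t}"
    by (rule bij_betw_nth) (auto simp: idx_def)
  from prod.reindex_bij_betw[OF this, of "\<lambda>i. [:- y i, 1:] ^ (lam ! i)"]
  have "p = (\<Prod>k<?t. [:- y (idx ! k), 1:] ^ (lam ! (idx ! k)))" by (simp add: p)
  also have "\<dots> = (\<Prod>k<length b. [:- y (idx ! k), 1:] ^ (b ! k))"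
    by (intro prod.cong) (auto simp: b_def len)
  finally have p': "p = (\<Prod>k<length b. [:- y (idx ! k), 1:] ^ (b ! k))" .
  have mono: "y (idx ! i) \<le> y (idx ! j)" if "i \<le> j" "j < length b" for i j
  proof -
    have "sorted (map y idx)" by (simp add: idx_def)
    then show ?thesis using that by (simp add: sorted_iff_nth_mono b_def)
  qed
  show ?thesis by (rule that[of b "\<lambda>k. y (idx ! k)", OF mb p']) (use mono in blast)
qed

lemma sum_telescope_Suc:
  fixes z :: "nat \<Rightarrow> 'a::ab_group_add"
  shows "(\<Sum>k\<in>{1..m}. z k - z (k - 1)) = z m - z 0"
  by (induction m) auto

text \<open>The gap vector puts the jump \<open>z k - z (k - 1)\<close> at the break where block
  \<open>k\<close> begins. Writing it as a sum over \<open>k\<close> avoids inverting the partial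
  sums; after exchanging the summations the jumps up to block \<open>m\<close> telescope.\<close>

lemma roots_of_gaps_of_blocks:
  fixes z :: "nat \<Rightarrow> real"
  assumes b0: "0 \<notin> set b" and m: "m < length b"
  shows "roots_of_gaps (\<lambda>i. \<Sum>k\<in>{1..<length b}. if sum_list (take k b) = i then z k - z (k - 1) else 0, z 0)
    (sum_list (take m b)) = z m"
proof -
  let ?S = "\<lambda>k. sum_list (take k b)"
  \<comment> \<open>Partial sums increase strictly, so the jumps met up to position
    \<open>?S m\<close> are exactly those of the blocks 1 to \<open>m\<close>.\<close>
  have iff: "?S k \<in> {1..?S m} \<longleftrightarrow> k \<in> {1..m}" if "k < length b" for k
    using sum_list_take_less_iff[OF b0, of 0 k] sum_list_take_less_iff[OF b0, of m k] that m by auto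
  have "(\<Sum>i\<in>{1..?S m}. \<Sum>k\<in>{1..<length b}. if ?S k = i then z k - z (k - 1) else 0)
    = (\<Sum>k\<in>{1..<length b}. \<Sum>i\<in>{1..?S m}. if ?S k = i then z k - z (k - 1) else 0)"
    by (rule sum.swap)
  also have "\<dots> = (\<Sum>k\<in>{1..<length b}. if ?S k \<in> {1..?S m} then z k - z (k - 1) else 0)"
    by (intro sum.cong refl sum.delta') simp
  also have "\<dots> = (\<Sum>k\<in>{1..<length b}. if k \<in> {1..m} then z k - z (k - 1) else 0)"
    by (intro sum.cong refl if_cong iff) auto
  also have "\<dots> = (\<Sum>k\<in>{1..<length b} \<inter> {1..m}. z k - z (k - 1))"
    by (simp only: sum.inter_restrict finite_atLeastLessThan)
  also have "{1..<length b} \<inter> {1..m} = {1..m}" using m by auto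
  also note sum_telescope_Suc
  finally show ?thesis unfolding roots_of_gaps_def by simp
qed

lemma hyp_polys_eq_image:
  assumes lam: "number_partition n lam"
  shows "(\<lambda>p. roots_poly n (roots_of_gaps p)) ` (cone_of (delta n lam) \<times> UNIV) = hyp_polys lam"
proof (intro equalityI subsetI)
  fix q assume "q \<in> (\<lambda>p. roots_poly n (roots_of_gaps p)) ` (cone_of (delta n lam) \<times> UNIV)"
  then show "q \<in> hyp_polys lam" using roots_poly_in_hyp_polys[OF lam] by auto
next
  fix q assume "q \<in> hyp_polys lam"
  then obtain b z where b: "mset b = mset lam" and q: "q = (\<Prod>k<length b. [:- z k, 1:] ^ (b ! k))"
    and mono: "\<forall>i j. i \<le> j \<longrightarrow> j < length b \<longrightarrow> z i \<le> z j"
    by (rule hyp_polys_sorted)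
  have cb: "composition n b"
    using lam b mset_eq_setD[OF b] by (auto simp: composition_def number_partition_def simp flip: sum_mset_sum_list)
  then have b0: "0 \<notin> set b" by (simp add: composition_def)
  define g where "g = (\<lambda>i. \<Sum>k\<in>{1..<length b}. if sum_list (take k b) = i then z k - z (k - 1) else 0)"
  have supp: "{i. g i \<noteq> 0} \<subseteq> breaks b"
  proof
    fix i assume "i \<in> {i. g i \<noteq> 0}"
    then have "g i \<noteq> 0" by simp
    then obtain k where "k \<in> {1..<length b}" "(if sum_list (take k b) = i then z k - z (k - 1) else 0) \<noteq> 0"
      unfolding g_def by (rule sum.not_neutral_contains_not_neutral)
    then have "0 < k" "k < length b" "i = sum_list (take k b)" by (auto split: if_splits)
    then show "i \<in> breaks b" unfolding breaks_def by blast
  qed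
  have "0 \<le> g i" for i
    unfolding g_def using mono by (intro sum_nonneg) auto
  moreover have "{i. g i \<noteq> 0} \<in> insert {} (delta n lam)"
  proof (cases "{i. g i \<noteq> 0} = {}")
    case False
    have "breaks b \<in> type_breaks n lam" using cb b unfolding type_breaks_def has_type_def by blast
    then have "{i. g i \<noteq> 0} \<in> delta n lam" using supp False unfolding delta_eq by blast
    then show ?thesis by (rule insertI2)
  qed simp
  ultimately have "g \<in> cone_of (delta n lam)" unfolding cone_of_def by blast
  moreover have "roots_poly n (roots_of_gaps (g, z 0)) = q"
  proof -
    have root: "roots_of_gaps (g, z 0) (sum_list (take k b)) = z k" if "k < length b" for k
      unfolding g_def by (rule roots_of_gaps_of_blocks[OF b0 that])
    have "roots_poly n (roots_of_gaps (g, z 0))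
        = (\<Prod>k<length b. [:- roots_of_gaps (g, z 0) (sum_list (take k b)), 1:] ^ (b ! k))"
      by (rule roots_poly_blocks[OF cb]) (simp add: supp)
    also have "\<dots> = q"
      unfolding q by (intro prod.cong refl) (simp add: root)
    finally show ?thesis .
  qed
  ultimately show "q \<in> (\<lambda>p. roots_poly n (roots_of_gaps p)) ` (cone_of (delta n lam) \<times> UNIV)"
    by (intro image_eqI[of _ _ "(g, z 0)"]) auto
qed

lemma roots_of_gaps_inject:
  assumes "p \<in> cone_of (delta n lam) \<times> UNIV" "q \<in> cone_of (delta n lam) \<times> UNIV" and n: "1 \<le> n"
    and eq: "\<And>j. j < n \<Longrightarrow> roots_of_gaps p j = roots_of_gaps q j"
  shows "p = q"
proof -
  have "snd p = snd q" using eq[of 0] n by (simp add: roots_of_gaps_def)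
  moreover have "fst p i = fst q i" for i
  proof (cases "i \<in> {1..<n}")
    case True
    then obtain j where j: "i = Suc j" by (cases i) auto
    then show ?thesis
      using True eq[of i] eq[of j] by (simp add: roots_of_gaps_Suc)
  next
    case False
    then have "i \<notin> \<Union>(delta n lam)" by (auto simp: delta_def)
    moreover have "fst p \<in> cone_of (delta n lam)" "fst q \<in> cone_of (delta n lam)" using assms(1,2) by auto
    ultimately show ?thesis by (simp add: cone_of_outside)
  qed
  ultimately show ?thesis by (simp add: prod_eq_iff fun_eq_iff)
qed

text \<open>Continuity of the inverse is a local matter. Near a given point the coefficients are
  bounded, so the preimages lie in a compact part of the cone times the line, and on a compact set a
  continuous injection has a continuous inverse.\<close>

lemma Hyp_homeomorphic_cone:
  assumes lam: "number_partition n lam" and n: "1 \<le> n"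
  shows "Hyp lam homeomorphic_space top_of_set (cone_of (delta n lam) \<times> (UNIV :: real set))"
proof -
  let ?Y = "cone_of (delta n lam) \<times> (UNIV :: real set)"
  define F where "F p = coeff (roots_poly n (roots_of_gaps p))" for p
  have nonneg: "0 \<le> fst p i" if "p \<in> ?Y" for p i
    using that by (auto intro: cone_of_nonneg)
  have "continuous_on S (\<lambda>p. roots_of_gaps p j)" for S j
    unfolding roots_of_gaps_def
    by (intro continuous_on_add continuous_on_snd continuous_on_id continuous_on_sum continuous_on_fst_coord)
  then have cF: "continuous_on S F" for S
    unfolding F_def by (rule continuous_on_coeff_roots_poly)
  have inj: "inj_on F ?Y"
  proof (rule inj_onI)
    fix p q assume pq: "p \<in> ?Y" "q \<in> ?Y" "F p = F q"
    then have "roots_poly n (roots_of_gaps p) = roots_poly n (roots_of_gaps q)"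
      by (simp add: F_def coeff_inject)
    then have "roots_of_gaps p j = roots_of_gaps q j" if "j < n" for j
      by (rule roots_poly_inject) (use that in \<open>auto intro!: roots_of_gaps_mono nonneg pq\<close>)
    then show "p = q" by (rule roots_of_gaps_inject[OF pq(1,2) n])
  qed
  define G where "G = inv_into ?Y F"
  have GF: "G (F p) = p" if "p \<in> ?Y" for p
    using inj that by (simp add: G_def)
  define box where "box c = PiE UNIV (\<lambda>_::nat. {0..c}) \<times> {-c..c}" for c :: real
  have compact_box: "compact (?Y \<inter> box c)" for c
  proof -
    have "compactin euclidean (PiE UNIV (\<lambda>_::nat. {0..c}))"
      unfolding euclidean_product_topology[symmetric] compactin_PiE by simp
    then have "compact (PiE UNIV (\<lambda>_::nat. {0..c}))" by (simp add: compactin_euclidean_iff)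
    then have "compact (box c)" unfolding box_def by (intro compact_Times) simp_all
    moreover have "closed ?Y" by (intro closed_Times closed_cone_of complex_on_delta closed_UNIV)
    ultimately show ?thesis by (simp add: compact_Int_closed Int_commute)
  qed
  \<comment> \<open>All roots are bounded by \<open>1 + n * c\<close>; a gap is the difference of
    two roots, which gives the factor 2. The same bound is generous for the smallest root.\<close>
  have in_box: "p \<in> box (2 * (1 + real n * c))"
    if p: "p \<in> ?Y" and c: "0 \<le> c" "\<And>k. k < n \<Longrightarrow> \<bar>F p k\<bar> \<le> c" for p c
  proof -
    let ?B = "1 + real n * c"
    have bd: "\<bar>roots_of_gaps p j\<bar> \<le> ?B" if "j < n" for j
      by (rule root_bound[OF roots_poly_monic poly_roots_poly[OF that]]) (use c in \<open>auto simp: F_def\<close>)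
    have "0 \<le> ?B" using c(1) by simp
    have "\<bar>snd p\<bar> \<le> 2 * ?B"
      using bd[of 0] n \<open>0 \<le> ?B\<close> by (simp add: roots_of_gaps_def)
    moreover have "fst p i \<le> 2 * ?B" for i
    proof (cases "i \<in> {1..<n}")
      case True
      then obtain j where j: "i = Suc j" by (cases i) auto
      then have "\<bar>roots_of_gaps p i\<bar> \<le> ?B" "\<bar>roots_of_gaps p j\<bar> \<le> ?B" using True bd by auto
      then have "roots_of_gaps p j + fst p i \<le> ?B" "- roots_of_gaps p j \<le> ?B"
        unfolding j roots_of_gaps_Suc by (simp_all only: abs_le_iff)
      then have "fst p i \<le> ?B + ?B" by linarith
      then show ?thesis by (simp only: mult_2)
    next
      case False
      then have "i \<notin> \<Union>(delta n lam)" by (auto simp: delta_def)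
      then have "fst p i = 0" using p cone_of_outside by auto
      then show ?thesis using \<open>0 \<le> ?B\<close> by simp
    qed
    ultimately show ?thesis
      using nonneg[OF p] by (cases p) (auto simp: box_def)
  qed
  have "continuous_on (F ` ?Y) G"
    unfolding continuous_on_eq_continuous_within
  proof
    fix z assume z: "z \<in> F ` ?Y"
    \<comment> \<open>The extra 1 makes the bounds on the coefficients of \<open>z\<close> strict,
      so they hold on an open neighbourhood \<open>U\<close>.\<close>
    define c where "c = 1 + (\<Sum>k<n. \<bar>z k\<bar>)"
    have c0: "0 \<le> c" by (simp add: c_def add_nonneg_nonneg sum_nonneg)
    define U where "U = (\<Inter>k\<in>{..<n}. {w. \<bar>w k\<bar> < c})"
    have "open {w::nat \<Rightarrow> real. \<bar>w k\<bar> < c}" for k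
      by (intro open_Collect_less continuous_on_rabs continuous_on_coord continuous_on_const)
    then have U: "open U" unfolding U_def by (intro open_INT) auto
    have "\<bar>z k\<bar> < c" if "k < n" for k
      using member_le_sum[of k "{..<n}" "\<lambda>k. \<bar>z k\<bar>"] that by (simp add: c_def)
    then have zU: "z \<in> U" by (simp add: U_def)
    let ?K = "?Y \<inter> box (2 * (1 + real n * c))"
    have cG: "continuous_on (F ` ?K) G"
      by (rule continuous_on_inv[OF cF compact_box]) (use GF in blast)
    have sub: "F ` ?Y \<inter> U \<subseteq> F ` ?K"
    proof
      fix w assume w: "w \<in> F ` ?Y \<inter> U"
      then obtain p where p: "p \<in> ?Y" "w = F p" by blast
      have "\<bar>F p k\<bar> \<le> c" if "k < n" for k
      proof -
        have "F p \<in> U" using w p(2) by simp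
        then have "\<bar>F p k\<bar> < c" using that by (simp add: U_def)
        then show ?thesis by simp
      qed
      then have "p \<in> ?K" using in_box[OF p(1) c0] p(1) by blast
      then show "w \<in> F ` ?K" using p(2) by blast
    qed
    have "continuous (at z within F ` ?Y \<inter> U) G"
      using continuous_on_subset[OF cG sub] z zU by (auto simp: continuous_on_eq_continuous_within)
    \<comment> \<open>Shrinking the domain to a neighbourhood of \<open>z\<close> does not affect
      continuity at \<open>z\<close>.\<close>
    moreover have "at z within F ` ?Y \<inter> U = at z within F ` ?Y"
      by (rule at_within_nhd[of _ U]) (use zU U in auto)
    ultimately show "continuous (at z within F ` ?Y) G" by simp
  qed
  moreover have "G z \<in> ?Y" "F (G z) = z" if z: "z \<in> F ` ?Y" for z
  proof -
    obtain p where p: "p \<in> ?Y" "z = F p" using z by blast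
    then show "G z \<in> ?Y" "F (G z) = z" by (simp_all only: GF)
  qed
  ultimately have "homeomorphic_maps (top_of_set ?Y) (top_of_set (F ` ?Y)) F G"
    unfolding homeomorphic_maps_def continuous_map_in_subtopology continuous_map_iff_continuous
      topspace_euclidean_subtopology
    using cF GF by (intro conjI ballI funcsetI imageI) simp_all
  then have "top_of_set ?Y homeomorphic_space top_of_set (F ` ?Y)"
    by (auto simp: homeomorphic_space_def)
  moreover have "F ` ?Y = coeff ` hyp_polys lam"
    unfolding hyp_polys_eq_image[OF lam, symmetric] image_image F_def by simp
  ultimately show ?thesis
    using Hyp_homeomorphic_coeffs[of lam] homeomorphic_space_sym homeomorphic_space_trans by metis
qed

section \<open>Compactified strata\<close>

lemma Alexandroff_Hyp_sphere:
  assumes "number_partition n lam" "1 \<le> n"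
  shows "Alexandroff_compactification (Hyp lam) homeomorphic_space top_of_set (sphere_of (delta n lam))"
  using homeomorphic_space_Alexandroff_compactification[OF Hyp_homeomorphic_cone[OF assms]]
    Alexandroff_cone_times_line[OF complex_on_delta] by (rule homeomorphic_space_trans)

lemma complex_on_C_poset: "complex_on (order_complex (comp_le n) (C_poset n lam))"
  by (intro complex_on_order_complex finite_C_poset)

text \<open>The detour over punctured cones changes the complex: the spheres at both ends are
  deformation retracts, and the homotopy equivalence is constructed between the punctured
  cones.\<close>

lemma Alexandroff_Hyp_homotopy_equivalent:
  assumes "number_partition n lam" "1 \<le> n"
  shows "Alexandroff_compactification (Hyp lam) homotopy_equivalent_space
    top_of_set (sphere_of (order_complex (comp_le n) (C_poset n lam)))"
proof -
  interpret face_cover "delta n lam" "closed_faces n lam" by (rule face_cover_closed_faces)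
  have "Alexandroff_compactification (Hyp lam) homotopy_equivalent_space top_of_set (sphere_of (delta n lam))"
    by (intro homeomorphic_imp_homotopy_equivalent_space Alexandroff_Hyp_sphere assms)
  also have "\<dots> homotopy_equivalent_space top_of_set (punctured_cone (delta n lam))"
    using punctured_cone_homotopy_equivalent_sphere[OF complex] homotopy_equivalent_space_sym by blast
  also have "\<dots> homotopy_equivalent_space top_of_set (punctured_cone OC)"
    by (rule punctured_cone_order_complex)
  also have "\<dots> homotopy_equivalent_space top_of_set (sphere_of OC)"
    by (rule punctured_cone_homotopy_equivalent_sphere[OF complex_OC])
  also have "\<dots> homotopy_equivalent_space
      top_of_set (sphere_of (order_complex (comp_le n) (C_poset n lam)))"
  proof -
    \<comment> \<open>Reversed and ordinary inclusion have the same chains, so the order-reversing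
      correspondence still yields isomorphic complexes.\<close>
    have "simplicial_iso (order_complex (comp_le n) (C_poset n lam)) OC"
      using poset_iso_order_complex[OF poset_iso_C_poset[OF assms(2)]] comp_le_refl C_poset_composition
      by (simp add: order_complex_dual[of "(\<subseteq>)"])
    then show ?thesis
      using simplicial_iso_sphere_of homeomorphic_space_sym homeomorphic_imp_homotopy_equivalent_space
      by blast
  qed
  finally show ?thesis .
qed

theorem theorem3p5:
  fixes n :: nat and lam :: "nat list"
  assumes "n \<ge> 2" and "number_partition n lam"
  shows
    "(Alexandroff_compactification (Hyp lam)
        homeomorphic_space suspension (suspension (realization (delta n lam)))
      \<and> (\<forall>m mu. m \<ge> 1 \<and> number_partition m mu
            \<and> simplicial_iso (delta n lam) (delta m mu) \<longrightarrow>
           Alexandroff_compactification (Hyp lam)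
             homeomorphic_space Alexandroff_compactification (Hyp mu)))
    \<and> (Alexandroff_compactification (Hyp lam)
        homotopy_equivalent_space
          suspension (suspension (realization (order_complex (comp_le n) (C_poset n lam))))
      \<and> (\<forall>m mu. m \<ge> 1 \<and> number_partition m mu
            \<and> poset_iso (comp_le n) (C_poset n lam) (comp_le m) (C_poset m mu) \<longrightarrow>
           Alexandroff_compactification (Hyp lam)
             homotopy_equivalent_space Alexandroff_compactification (Hyp mu)))"
proof (intro conjI allI impI)
  have n: "1 \<le> n" using assms(1) by simp
  note lam = assms(2)
  note sphere = Alexandroff_Hyp_sphere[OF lam n]
    and poset = Alexandroff_Hyp_homotopy_equivalent[OF lam n]
  show "Alexandroff_compactification (Hyp lam)
      homeomorphic_space suspension (suspension (realization (delta n lam)))"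
    using sphere double_suspension_realization[OF complex_on_delta, THEN homeomorphic_space_sym[THEN iffD1]]
    by (rule homeomorphic_space_trans)
  show "Alexandroff_compactification (Hyp lam) homotopy_equivalent_space
      suspension (suspension (realization (order_complex (comp_le n) (C_poset n lam))))"
    using poset homeomorphic_imp_homotopy_equivalent_space[OF
        double_suspension_realization[OF complex_on_C_poset, THEN homeomorphic_space_sym[THEN iffD1]]]
    by (rule homotopy_eqv_trans)
  fix m mu
  {
    assume m: "m \<ge> 1 \<and> number_partition m mu \<and> simplicial_iso (delta n lam) (delta m mu)"
    \<comment> \<open>The sphere depends on the complex alone, so an isomorphism that relabels its
      coordinates can connect different \<open>n\<close> and \<open>m\<close>.\<close>
    have "Alexandroff_compactification (Hyp lam) homeomorphic_space top_of_set (sphere_of (delta m mu))"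
      using sphere simplicial_iso_sphere_of m by (blast intro: homeomorphic_space_trans)
    also have "\<dots> homeomorphic_space Alexandroff_compactification (Hyp mu)"
      using Alexandroff_Hyp_sphere m homeomorphic_space_sym by blast
    finally show "Alexandroff_compactification (Hyp lam)
      homeomorphic_space Alexandroff_compactification (Hyp mu)" .
  }
  {
    assume m: "m \<ge> 1 \<and> number_partition m mu
      \<and> poset_iso (comp_le n) (C_poset n lam) (comp_le m) (C_poset m mu)"
    then have "simplicial_iso (order_complex (comp_le n) (C_poset n lam))
        (order_complex (comp_le m) (C_poset m mu))"
      using poset_iso_order_complex comp_le_refl C_poset_composition by blast
    then have "Alexandroff_compactification (Hyp lam) homotopy_equivalent_space
        top_of_set (sphere_of (order_complex (comp_le m) (C_poset m mu)))"
      using poset simplicial_iso_sphere_of homeomorphic_imp_homotopy_equivalent_space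
      by (blast intro: homotopy_eqv_trans)
    also have "\<dots> homotopy_equivalent_space Alexandroff_compactification (Hyp mu)"
      using Alexandroff_Hyp_homotopy_equivalent m homotopy_equivalent_space_sym by blast
    finally show "Alexandroff_compactification (Hyp lam)
      homotopy_equivalent_space Alexandroff_compactification (Hyp mu)" .
  }
qed

end
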